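(* For every positive integer $d$ there is a short Presburger formula $$F(x;y) \;=\; \exists\, \mathbf{u}\;\forall\, \mathbf{v}\;\; \Psi(x,y,\mathbf{u},\mathbf{v})$$ in the class $\text{Short-PA}_{10,18}$, where $x,y$ are single integer variables ($x$ the object variable, $y$ the parameter variable), $\mathbf{u},\mathbf{v}$ are tuples of integer variables, and $\Psi$ is a Boolean combination of linear inequalities, such that $$\phi(F) = O(d^3) \qquad\text{and}\qquad \mathrm{VC}(F)\ge d,$$ where the constant in $O(\cdot)$ is absolute. Moreover, $\Psi$ can be computed (from $d$) in deterministic polynomial time in $d$.
   Context: Presburger Arithmetic (PA) is the first-order theory of the structure $(\mathbb{Z},<,+)$. The atoms of a PA-formula are linear inequalities in its variables with integer coefficients and constants, written in binary; all variables, free and quantified, range over $\mathbb{Z}$. The length $\phi(F)$ of a PA-formula $F$ is the total bit length of all symbols, operations, integer coefficients and constants in $F$. For fixed $k,t$, $\text{Short-PA}_{k,t}$ denotes the family of PA-formulas with at most $k$ variables (free and quantified variables counted together) and at most $t$ inequalities; members of such a class are called short Presburger formulas. VC-dimension: let $X$ be a set and $\mathcal{S}\subseteq 2^X$. A subset $A\subseteq X$ is shattered by $\mathcal{S}$ if for every $B\subseteq A$ there is $S\in\mathcal{S}$ with $B=S\cap A$. $\mathrm{VC}(\mathcal{S})$ is the largest size of a subset of $X$ shattered by $\mathcal{S}$ ($\infty$ if no largest size exists). For a partitioned PA-formula $F(\mathbf{x};\mathbf{y})$ with object variables $\mathbf{x}\in\mathbb{Z}^m$ and parameter variables $\mathbf{y}\in\mathbb{Z}^n$,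 let $S_{b}=\{\mathbf{x}\in\mathbb{Z}^m : F(\mathbf{x};b)\text{ is true}\}$ for $b\in\mathbb{Z}^n$, let $\mathcal{S}_F=\{S_b : b\in\mathbb{Z}^n\}\subseteq 2^{\mathbb{Z}^m}$, and put $\mathrm{VC}(F)=\mathrm{VC}(\mathcal{S}_F)$. *)

theory Defs
  imports Complex_Main "HOL-Library.Extended_Nat"
begin

section \<open>Presburger formulas\<close>

text \<open>Variables are named by natural numbers. The atom \<open>Ineq [(a1, v1), \<dots>, (an, vn)] b\<close>
  is the inequality \<open>a1 * v1 + \<dots> + an * vn \<le> b\<close>; over the integers, strict inequalities
  are of this form as well. An equation has to be written with two atoms.\<close>

datatype pa =
    Ineq "(int \<times> nat) list" int
  | Neg pa
  | And pa pa
  | Or pa pa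
  | Ex nat pa
  | All nat pa

fun sat :: "pa \<Rightarrow> (nat \<Rightarrow> int) \<Rightarrow> bool" where
  "sat (Ineq ts b) e \<longleftrightarrow> (\<Sum>(a, v)\<leftarrow>ts. a * e v) \<le> b"
| "sat (Neg F) e \<longleftrightarrow> \<not> sat F e"
| "sat (And F G) e \<longleftrightarrow> sat F e \<and> sat G e"
| "sat (Or F G) e \<longleftrightarrow> sat F e \<or> sat G e"
| "sat (Ex v F) e \<longleftrightarrow> (\<exists>z. sat F (e(v := z)))"
| "sat (All v F) e \<longleftrightarrow> (\<forall>z. sat F (e(v := z)))"

fun free_vars :: "pa \<Rightarrow> nat set" where
  "free_vars (Ineq ts b) = snd ` set ts"
| "free_vars (Neg F) = free_vars F"
| "free_vars (And F G) = free_vars F \<union> free_vars G"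
| "free_vars (Or F G) = free_vars F \<union> free_vars G"
| "free_vars (Ex v F) = free_vars F - {v}"
| "free_vars (All v F) = free_vars F - {v}"

fun num_quants :: "pa \<Rightarrow> nat" where
  "num_quants (Ineq ts b) = 0"
| "num_quants (Neg F) = num_quants F"
| "num_quants (And F G) = num_quants F + num_quants G"
| "num_quants (Or F G) = num_quants F + num_quants G"
| "num_quants (Ex v F) = Suc (num_quants F)"
| "num_quants (All v F) = Suc (num_quants F)"

fun num_ineqs :: "pa \<Rightarrow> nat" where
  "num_ineqs (Ineq ts b) = 1"
| "num_ineqs (Neg F) = num_ineqs F"
| "num_ineqs (And F G) = num_ineqs F + num_ineqs G"
| "num_ineqs (Or F G) = num_ineqs F + num_ineqs G"
| "num_ineqs (Ex v F) = num_ineqs F"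
| "num_ineqs (All v F) = num_ineqs F"

text \<open>Each quantifier occurrence counts as a variable of its own, so that re-using
  a name for a second bound variable does not lower the count.\<close>

definition Short_PA :: "nat \<Rightarrow> nat \<Rightarrow> pa set" where
  "Short_PA k t = {F. card (free_vars F) + num_quants F \<le> k \<and> num_ineqs F \<le> t}"

definition quantifier_free :: "pa \<Rightarrow> bool" where
  "quantifier_free F \<longleftrightarrow> num_quants F = 0"

abbreviation Exs :: "nat list \<Rightarrow> pa \<Rightarrow> pa" where
  "Exs us F \<equiv> foldr Ex us F"

abbreviation Alls :: "nat list \<Rightarrow> pa \<Rightarrow> pa" where
  "Alls vs F \<equiv> foldr All vs F"


section \<open>Formulas as words, and their length\<close>

text \<open>Formulas are written in prefix notation, with integers in binary (most significant
  digit first): \<open>5 * v3 - 2 * v0 \<le> 7\<close> becomes the word \<open>+ 101 v 11 + -10 v 0 \<le> 111\<close>.\<close>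

datatype letter = D0 | D1 | Minus | Plus | Var | Leq | LNeg | LAnd | LOr | LEx | LAll

fun nat_word :: "nat \<Rightarrow> letter list" where
  "nat_word n = (if n < 2 then [] else nat_word (n div 2)) @ [if even n then D0 else D1]"

declare nat_word.simps [simp del]

definition int_word :: "int \<Rightarrow> letter list" where
  "int_word i = (if i < 0 then [Minus] else []) @ nat_word (nat \<bar>i\<bar>)"

fun encode :: "pa \<Rightarrow> letter list" where
  "encode (Ineq ts b) =
     concat (map (\<lambda>(a, v). [Plus] @ int_word a @ [Var] @ nat_word v) ts) @ [Leq] @ int_word b"
| "encode (Neg F) = [LNeg] @ encode F"
| "encode (And F G) = [LAnd] @ encode F @ encode G"
| "encode (Or F G) = [LOr] @ encode F @ encode G"
| "encode (Ex v F) = [LEx] @ nat_word v @ encode F"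
| "encode (All v F) = [LAll] @ nat_word v @ encode F"

text \<open>There are eleven letters, so each of them takes four bits.\<close>

definition pa_length :: "pa \<Rightarrow> nat" where
  "pa_length F = 4 * length (encode F)"


section \<open>VC-dimension\<close>

text \<open>A shattered set is contained in a member of the family, hence in the ground set,
  which therefore need not be mentioned. If arbitrarily large finite sets are shattered,
  or an infinite one, the supremum is \<open>\<infinity>\<close>.\<close>

definition shatters :: "'a set set \<Rightarrow> 'a set \<Rightarrow> bool" where
  "shatters \<S> A \<longleftrightarrow> (\<forall>B\<subseteq>A. \<exists>S\<in>\<S>. B = S \<inter> A)"

definition VC :: "'a set set \<Rightarrow> enat" where
  "VC \<S> = (SUP A\<in>{A. finite A \<and> shatters \<S> A}. enat (card A))"

text \<open>Elements of \<open>\<int>\<^sup>m\<close> are integer lists of length \<open>m\<close>. Variables outside \<open>xs @ ys\<close> get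
  the value \<open>0\<close>; this is immaterial if all free variables are among \<open>xs @ ys\<close>.\<close>

definition assign :: "nat list \<Rightarrow> int list \<Rightarrow> nat \<Rightarrow> int" where
  "assign vs as v = (case map_of (zip vs as) v of Some a \<Rightarrow> a | None \<Rightarrow> 0)"

definition pa_set :: "nat list \<Rightarrow> nat list \<Rightarrow> pa \<Rightarrow> int list \<Rightarrow> int list set" where
  "pa_set xs ys F b = {a. length a = length xs \<and> sat F (assign (xs @ ys) (a @ b))}"

definition pa_family :: "nat list \<Rightarrow> nat list \<Rightarrow> pa \<Rightarrow> int list set set" where
  "pa_family xs ys F = {pa_set xs ys F b | b. length b = length ys}"

definition VC_pa :: "nat list \<Rightarrow> nat list \<Rightarrow> pa \<Rightarrow> enat" where
  "VC_pa xs ys F = VC (pa_family xs ys F)"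


section \<open>Deterministic polynomial time\<close>

text \<open>Deterministic multi-tape Turing machines over the finite alphabet of letters, with
  \<open>None\<close> as the blank. A tape is its contents together with the head position. It is
  infinite to the right only; moving left from cell \<open>0\<close> has no effect.

  A machine is a finite list of rows. The states are the natural numbers, \<open>0\<close> is initial,
  and row \<open>q\<close> says what to do in state \<open>q\<close>: given the list of scanned symbols, the next state
  and, for the tape with each index, the symbol to write and the head move. States without
  a row are halting. On \<open>k\<close> tapes only the lists of length \<open>k\<close> and the indices below \<open>k\<close> matter,
  so that each row amounts to a finite table.\<close>

datatype move = MLeft | MStay | MRight

type_synonym tape = "(nat \<Rightarrow> letter option) \<times> nat"
type_synonym config = "nat \<times> tape list"
type_synonym tm = "(letter option list \<Rightarrow> nat \<times> (nat \<Rightarrow> letter option \<times> move)) list"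

fun move_head :: "move \<Rightarrow> nat \<Rightarrow> nat" where
  "move_head MLeft h = h - 1"
| "move_head MStay h = h"
| "move_head MRight h = h + 1"

fun update_tape :: "letter option \<times> move \<Rightarrow> tape \<Rightarrow> tape" where
  "update_tape (s, m) (f, h) = (f(h := s), move_head m h)"

fun tm_step :: "tm \<Rightarrow> config \<Rightarrow> config" where
  "tm_step M (q, ts) =
    (if q < length M
     then let (q', act) = (M ! q) (map (\<lambda>(f, h). f h) ts)
          in (q', map (\<lambda>i. update_tape (act i) (ts ! i)) [0..<length ts])
     else (q, ts))"

definition tape_contents :: "letter list \<Rightarrow> nat \<Rightarrow> letter option" where
  "tape_contents w = (\<lambda>i. if i < length w then Some (w ! i) else None)"

definition initial_config :: "nat \<Rightarrow> letter list \<Rightarrow> config" where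
  "initial_config k w = (0, (tape_contents w, 0) # replicate (k - 1) (tape_contents [], 0))"

text \<open>The input is on tape \<open>0\<close>; the output is the complete contents of tape \<open>1\<close>.\<close>

definition computes_in_time ::
    "tm \<Rightarrow> nat \<Rightarrow> letter list \<Rightarrow> letter list \<Rightarrow> nat \<Rightarrow> bool" where
  "computes_in_time M k w out T \<longleftrightarrow>
    (\<exists>t\<le>T. \<exists>q ts. (tm_step M ^^ t) (initial_config k w) = (q, ts) \<and>
       q \<ge> length M \<and> fst (ts ! 1) = tape_contents out)"

text \<open>Time polynomial in the number \<open>d\<close> itself, hence unary input.\<close>

definition poly_time_computable :: "(nat \<Rightarrow> letter list) \<Rightarrow> bool" where
  "poly_time_computable g \<longleftrightarrow>
    (\<exists>M k c e. k \<ge> 2 \<and>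
       (\<forall>d\<ge>1. computes_in_time M k (replicate d D1) (g d) (c * d ^ e)))"


section \<open>The encoding of formulas is injective\<close>

definition no_digit :: "letter list \<Rightarrow> bool" where
  "no_digit r \<longleftrightarrow> (case r of [] \<Rightarrow> True | l # _ \<Rightarrow> l \<notin> {D0, D1})"

lemma no_digit_simps [simp]:
  "no_digit []" "no_digit (l # r) \<longleftrightarrow> l \<noteq> D0 \<and> l \<noteq> D1"
  by (auto simp: no_digit_def)

lemma set_nat_word: "set (nat_word n) \<subseteq> {D0, D1}"
  by (induction n rule: nat_word.induct) (subst nat_word.simps, auto)

lemma nat_word_neq_Nil [simp]: "nat_word n \<noteq> []"
  by (subst nat_word.simps) auto

definition word_nat :: "letter list \<Rightarrow> nat" where
  "word_nat w = foldl (\<lambda>n l. 2 * n + (if l = D1 then 1 else 0)) 0 w"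

lemma word_nat_nat_word: "word_nat (nat_word n) = n"
proof (induction n rule: nat_word.induct)
  case (1 n)
  show ?case
  proof (cases "n < 2")
    case True
    then have "n = 0 \<or> n = 1" by auto
    then show ?thesis by (subst nat_word.simps) (auto simp: word_nat_def)
  next
    case False
    then have "word_nat (nat_word (n div 2)) = n div 2" using 1 by simp
    with False show ?thesis
      by (subst nat_word.simps) (auto simp: word_nat_def elim: oddE)
  qed
qed

lemma takeWhile_nat_word:
  assumes "no_digit r"
  shows "takeWhile (\<lambda>l. l \<in> {D0, D1}) (nat_word n @ r) = nat_word n"
proof -
  have "takeWhile (\<lambda>l. l \<in> {D0, D1}) r = []"
    using assms by (cases r) auto
  then show ?thesis
    using set_nat_word[of n] by (subst takeWhile_append2) auto
qed

lemma nat_word_append_eq: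
  assumes "nat_word n @ r = nat_word m @ s" "no_digit r" "no_digit s"
  shows "n = m \<and> r = s"
proof -
  have eq: "nat_word n = nat_word m"
    using assms takeWhile_nat_word by metis
  then have "n = m" by (metis word_nat_nat_word)
  with assms show ?thesis by simp
qed

lemma hd_nat_word: "nat_word n = l # w \<Longrightarrow> l \<noteq> Minus"
  using set_nat_word[of n] by auto

lemma int_word_append_eq:
  assumes "int_word i @ r = int_word j @ s" "no_digit r" "no_digit s"
  shows "i = j \<and> r = s"
proof -
  have *: "nat_word n @ r' \<noteq> Minus # s'" for n r' s'
    by (cases "nat_word n") (auto dest: hd_nat_word)
  have "i < 0 \<longleftrightarrow> j < 0"
    using assms(1) * *[symmetric] by (auto simp: int_word_def split: if_splits)
  moreover from this have "nat_word (nat \<bar>i\<bar>) @ r = nat_word (nat \<bar>j\<bar>) @ s"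
    using assms(1) by (auto simp: int_word_def split: if_splits)
  from nat_word_append_eq[OF this assms(2,3)] have "nat \<bar>i\<bar> = nat \<bar>j\<bar>" "r = s" by auto
  ultimately show ?thesis by (auto split: if_splits)
qed

lemma no_digit_encode [simp]: "no_digit (encode F @ r)"
proof (cases F)
  case (Ineq ts b)
  then show ?thesis by (cases ts) auto
qed auto

lemma no_digit_Ineq [simp]:
  "no_digit (concat (map (\<lambda>(a, v). Plus # int_word a @ Var # nat_word v) ts) @ Leq # r)"
  by (cases ts) auto

lemma Ineq_append_eq:
  assumes "encode (Ineq ts b) @ r = encode (Ineq ts' b') @ s" "no_digit r" "no_digit s"
  shows "ts = ts' \<and> b = b' \<and> r = s"
  using assms(1)
proof (induction ts arbitrary: ts')
  case Nil
  then show ?case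
    using assms(2,3) by (cases ts') (auto dest: int_word_append_eq)
next
  case (Cons t ts)
  obtain t' ts'' where ts': "ts' = t' # ts''"
    using Cons.prems by (cases ts'; cases t) auto
  obtain a v a' v' where t: "t = (a, v)" "t' = (a', v')" by (cases t; cases t')
  from Cons.prems have "int_word a @ Var # nat_word v @ encode (Ineq ts b) @ r =
      int_word a' @ Var # nat_word v' @ encode (Ineq ts'' b') @ s"
    by (simp add: ts' t)
  from int_word_append_eq[OF this] have "a = a'"
    and "nat_word v @ encode (Ineq ts b) @ r = nat_word v' @ encode (Ineq ts'' b') @ s" by auto
  from this(1) nat_word_append_eq[OF this(2)] Cons.IH show ?case
    unfolding ts' t using no_digit_encode by blast
qed

lemma Ineq_neq [simp]:
  assumes "l \<noteq> Plus" "l \<noteq> Leq"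
  shows "l # w \<noteq> concat (map (\<lambda>(a, v). Plus # int_word a @ Var # nat_word v) ts) @ Leq # r"
    and "concat (map (\<lambda>(a, v). Plus # int_word a @ Var # nat_word v) ts) @ Leq # r \<noteq> l # w"
  using assms by (cases ts; auto)+

lemma encode_append_eq:
  assumes "encode F @ r = encode G @ s" "no_digit r" "no_digit s"
  shows "F = G \<and> r = s"
  using assms
proof (induction F arbitrary: G r s)
  case (Ineq ts b)
  obtain ts' b' where "G = Ineq ts' b'"
    using Ineq.prems(1) by (cases G) simp_all
  then show ?case using Ineq_append_eq Ineq.prems by blast
next
  case (Neg F)
  obtain G' where "G = Neg G'"
    using Neg.prems(1) by (cases G) simp_all
  with Neg show ?case by auto
next
  case (And F1 F2)
  obtain G1 G2 where G: "G = And G1 G2"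
    using And.prems(1) by (cases G) simp_all
  with And.prems have "encode F1 @ encode F2 @ r = encode G1 @ encode G2 @ s" by simp
  from And.IH(1)[OF this] And.IH(2)[of r G2 s] And.prems G show ?case by auto
next
  case (Or F1 F2)
  obtain G1 G2 where G: "G = Or G1 G2"
    using Or.prems(1) by (cases G) simp_all
  with Or.prems have "encode F1 @ encode F2 @ r = encode G1 @ encode G2 @ s" by simp
  from Or.IH(1)[OF this] Or.IH(2)[of r G2 s] Or.prems G show ?case by auto
next
  case (Ex v F)
  obtain v' G' where G: "G = Ex v' G'"
    using Ex.prems(1) by (cases G) simp_all
  with Ex.prems have "nat_word v @ encode F @ r = nat_word v' @ encode G' @ s" by simp
  from nat_word_append_eq[OF this] Ex.IH[of r G' s] Ex.prems G show ?case by auto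
next
  case (All v F)
  obtain v' G' where G: "G = All v' G'"
    using All.prems(1) by (cases G) simp_all
  with All.prems have "nat_word v @ encode F @ r = nat_word v' @ encode G' @ s" by simp
  from nat_word_append_eq[OF this] All.IH[of r G' s] All.prems G show ?case by auto
qed

lemma inj_encode: "inj encode"
  using encode_append_eq[of _ "[]" _ "[]"] by (auto intro: injI)

end

(* Put T = 2^(d+1). The recursion V' = V + T D, D' = D + V', started at V = (1,0), D = (0,1), runs
   along the boundary of the convex hull of the nonzero lattice points of a plane cone, the edges
   being V_k + t D_k with 0 <= t <= T. These points are exactly the irreducible elements of the
   semigroup of lattice points of the cone, which is a "forall" condition with two variables.
   Since 2T = 1 modulo M = 2T - 1, the matrix of the recursion has the eigenvalue 2 there, and
   X + 2Y = 2^k (1 + 2t) modulo M at the point (X,Y) = V_k + t D_k, while Y = t modulo T. So one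
   congruence fixes t in terms of the parameter y, and the other one tests a binary digit of y
   whose position depends on the edge k; the edge is selected by the object variable, of value
   x_k = (second coordinate of D_k), through x_k <= Y < T x_k.

   The slope of the cone has O(d^2) binary digits and arises from d rounds of two additions, one of
   them shifted by d + 1 digits, which is what the Turing machine does. *)

theory Submission
  imports Defs "HOL-Number_Theory.Cong"
begin

section \<open>Lattice points of a cone\<close>

text \<open>In coordinates, \<open>V_k = (alpha T k, T * beta T k)\<close> and
  \<open>D_k = (beta T k, alpha T (Suc k))\<close>, so two sequences suffice; they are the
  continuants of a continued fraction with partial quotients \<open>T\<close> and 1 in turn. The
  obstacle is that the number of atoms is fixed, so the d digit tests have to be packed into the
  coefficients: one slope of a cone carries all edges. The modulus is forced: one round maps
  \<open>(alpha, beta)\<close> by a matrix of trace \<open>T + 2\<close> and determinant 1, whose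
  characteristic polynomial takes the value \<open>1 - 2 * T\<close> at 2. Modulo
  \<open>2 * T - 1\<close> the rounds thus double a suitable linear form, and doubling modulo
  \<open>2 ^ (d + 2) - 1\<close> rotates d + 2 binary digits, which brings a digit chosen by the
  edge to the top, where one comparison reads it. Modulo \<open>T\<close>, by contrast, the position
  on the edge is seen independently of the edge. The parameter is taken odd,
  \<open>y = 1 + 2 * s\<close> with d free digits in \<open>s\<close>; this keeps it positive, so
  that it is the position of a point strictly inside an edge, and explains the exponent d + 1 in
  \<open>T\<close>.\<close>

fun alpha beta :: "int \<Rightarrow> nat \<Rightarrow> int" where
  "alpha T 0 = 1"
| "alpha T (Suc k) = alpha T k + T * beta T k"
| "beta T 0 = 0"
| "beta T (Suc k) = beta T k + (alpha T k + T * beta T k)"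

lemma alpha_beta_nonneg: "T \<ge> 0 \<Longrightarrow> alpha T k \<ge> 1 \<and> beta T k \<ge> 0"
  by (induction k) (auto simp: add_increasing add_nonneg_nonneg add_increasing2)

lemmas alpha_pos = alpha_beta_nonneg[THEN conjunct1]
  and beta_nonneg = alpha_beta_nonneg[THEN conjunct2]

lemma beta_Suc: "beta T (Suc k) = beta T k + alpha T (Suc k)"
  by simp

declare alpha.simps(2) [simp del] beta.simps(2) [simp del]

lemma beta_pos: "T \<ge> 0 \<Longrightarrow> beta T (Suc k) \<ge> 1"
  using alpha_pos[of T "Suc k"] beta_nonneg[of T k] by (simp add: beta_Suc)

lemma beta_mono: "T \<ge> 0 \<Longrightarrow> j \<le> k \<Longrightarrow> beta T j \<le> beta T k"
  by (rule lift_Suc_mono_le[of "beta T"])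
    (auto simp: beta_Suc intro: order_trans[OF _ alpha_pos])

lemma alpha_Suc_strict_mono:
  assumes "T > 0" "j < k"
  shows "alpha T (Suc j) < alpha T (Suc k)"
proof -
  have "T * beta T (Suc i) > 0" for i
    using beta_pos[of T i] assms(1) by (intro mult_pos_pos) auto
  then have "alpha T (Suc i) < alpha T (Suc (Suc i))" for i
    by (simp add: alpha.simps(2)[of T "Suc _"])
  then show ?thesis
    using lift_Suc_mono_less[of "\<lambda>i. alpha T (Suc i)"] assms(2) by blast
qed

section \<open>Determinants of vertices and edge directions\<close>

text \<open>This is the determinant of \<open>V_k\<close> and \<open>D_k\<close>. Each round
  consists of two shears, which preserve it; hence \<open>V_k\<close> and \<open>D_k\<close> are a
  basis of the lattice.\<close>

lemma det_1: "alpha T k * alpha T (Suc k) - T * beta T k * beta T k = 1"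
  by (induction k) (auto simp: alpha.simps beta.simps algebra_simps)

text \<open>The determinants of \<open>V_(k+i)\<close> and of \<open>D_(k+i)\<close> against
  \<open>D_k\<close>. The recursion expresses each by both with nonnegative coefficients, so one
  induction has to treat them together. Their signs say that \<open>D_k\<close> is at least as steep
  as all later vertices and directions.\<close>

lemma det_vertex_step:
  assumes "T \<ge> 0"
  shows "alpha T (k + i) * alpha T (Suc k) - T * beta T (k + i) * beta T k \<ge> 1 \<and>
    beta T (k + i) * alpha T (Suc k) - alpha T (Suc (k + i)) * beta T k \<ge> 0"
proof (induction i)
  case 0
  show ?case using det_1[of T k] by (simp add: mult.commute)
next
  case (Suc i)
  let ?v = "alpha T (k + i) * alpha T (Suc k) - T * beta T (k + i) * beta T k"
  let ?w = "beta T (k + i) * alpha T (Suc k) - alpha T (Suc (k + i)) * beta T k"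
  have v: "alpha T (k + Suc i) * alpha T (Suc k) - T * beta T (k + Suc i) * beta T k = ?v + T * ?w"
    by (simp add: alpha.simps beta.simps algebra_simps)
  have w: "beta T (k + Suc i) * alpha T (Suc k) - alpha T (Suc (k + Suc i)) * beta T k = ?w + (?v + T * ?w)"
    by (simp add: alpha.simps beta.simps algebra_simps)
  have "T * ?w \<ge> 0" using Suc assms by (intro mult_nonneg_nonneg) auto
  with Suc show ?case unfolding v w by linarith
qed

text \<open>The same coupled induction for \<open>V_j\<close> against \<open>V_(j+i)\<close> and
  \<open>D_(j+i)\<close>: the slopes of the vertices do not decrease.\<close>

lemma det_vertices:
  assumes "T \<ge> 0"
  shows "alpha T j * (T * beta T (j + i)) - T * beta T j * alpha T (j + i) \<ge> 0 \<and>
    alpha T j * alpha T (Suc (j + i)) - T * beta T j * beta T (j + i) \<ge> 0"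
proof (induction i)
  case 0
  show ?case using det_1[of T j] by (simp add: mult_ac)
next
  case (Suc i)
  let ?v = "alpha T j * (T * beta T (j + i)) - T * beta T j * alpha T (j + i)"
  let ?w = "alpha T j * alpha T (Suc (j + i)) - T * beta T j * beta T (j + i)"
  have v: "alpha T j * (T * beta T (j + Suc i)) - T * beta T j * alpha T (j + Suc i) = ?v + T * ?w"
    by (simp add: alpha.simps beta.simps algebra_simps)
  have w: "alpha T j * alpha T (Suc (j + Suc i)) - T * beta T j * beta T (j + Suc i)
      = ?w + (?v + T * ?w)"
    by (simp add: alpha.simps beta.simps algebra_simps)
  have "T * ?w \<ge> 0" using Suc assms by (intro mult_nonneg_nonneg) auto
  with Suc show ?case unfolding v w by linarith
qed

section \<open>Irreducible points of the cone and the edges of its boundary\<close>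

text \<open>The upper ray passes through the vertex \<open>V_n\<close>, so that the edges with index
  below \<open>n\<close> lie in the cone.\<close>

definition in_cone :: "int \<Rightarrow> nat \<Rightarrow> int \<Rightarrow> int \<Rightarrow> bool" where
  "in_cone T n a b \<longleftrightarrow> 0 \<le> b \<and> alpha T n * b \<le> T * beta T n * a"

text \<open>In the cone, \<open>a \<ge> 1\<close> just excludes the origin.\<close>

definition irreducible_in_cone :: "int \<Rightarrow> nat \<Rightarrow> int \<Rightarrow> int \<Rightarrow> bool" where
  "irreducible_in_cone T n X Y \<longleftrightarrow> in_cone T n X Y \<and>
    \<not> (\<exists>a b. in_cone T n a b \<and> in_cone T n (X - a) (Y - b) \<and> 1 \<le> a \<and> a \<le> X - 1)"

lemma in_cone_combination:
  assumes "T \<ge> 0" "k < n" "0 \<le> m" "0 \<le> t" "t \<le> T * m"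
  shows "in_cone T n (m * alpha T k + t * beta T k) (m * (T * beta T k) + t * alpha T (Suc k))"
proof -
  obtain i where n: "n = Suc k + i" using assms(2) less_iff_Suc_add by auto
  let ?v = "alpha T (Suc k) * (T * beta T n) - T * beta T (Suc k) * alpha T n"
  let ?w = "alpha T n * alpha T (Suc k) - T * beta T n * beta T k"
  have "?v \<ge> 0" using det_vertices[OF assms(1), of "Suc k" i] n by simp
  moreover have "?w \<ge> 0" using det_vertex_step[OF assms(1), of k "Suc i"] n by simp
  \<comment> \<open>The point is \<open>m * V_(k+1) - (T * m - t) * D_k\<close>, and its determinant
    against \<open>V_n\<close> is this sum.\<close>
  ultimately have "m * ?v + (T * m - t) * ?w \<ge> 0"
    using assms by (intro add_nonneg_nonneg mult_nonneg_nonneg) auto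
  also have "m * ?v + (T * m - t) * ?w = T * beta T n * (m * alpha T k + t * beta T k)
      - alpha T n * (m * (T * beta T k) + t * alpha T (Suc k))"
    by (simp add: alpha.simps beta.simps algebra_simps)
  finally show ?thesis
    using assms beta_nonneg[of T k] alpha_pos[of T "Suc k"] by (auto simp: in_cone_def)
qed

text \<open>The functional is the determinant against \<open>D_k\<close>. Since \<open>D_k\<close>
  is steeper than \<open>V_n\<close>, it is steeper than every nonzero vector of the cone, so the
  value is positive, and being an integer it is at least 1.\<close>

lemma functional_pos:
  assumes "T > 0" "k < n" "in_cone T n a b" "1 \<le> a"
  shows "a * alpha T (Suc k) - b * beta T k \<ge> 1"
proof -
  obtain n' where n': "n = Suc n'" using assms(2) by (cases n) auto
  have q: "T * beta T n > 0"
    using beta_pos[of T n'] assms(1) n' by (intro mult_pos_pos) auto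
  obtain i where i: "n = k + i" using assms(2) less_iff_Suc_add by (metis add_Suc_right)
  have w: "alpha T n * alpha T (Suc k) - T * beta T n * beta T k \<ge> 1" (is "?w \<ge> 1")
    using det_vertex_step[of T k i] assms(1) i by simp
  have b: "b \<ge> 0" and ab: "alpha T n * b \<le> T * beta T n * a"
    using assms(3) by (auto simp: in_cone_def)
  have p: "alpha T n \<ge> 1" "alpha T (Suc k) \<ge> 1" using alpha_pos assms(1) by simp_all
  have "T * beta T n * (a * alpha T (Suc k) - b * beta T k)
      = alpha T (Suc k) * (T * beta T n * a - alpha T n * b) + b * ?w"
    by (simp add: algebra_simps)
  moreover have "0 < alpha T (Suc k) * (T * beta T n * a - alpha T n * b) + b * ?w"
  proof (cases "b = 0")
    case True
    have qa: "0 < T * beta T n * a" using assms(4) by (intro mult_pos_pos[OF q]) auto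
    have "0 < alpha T (Suc k) * (T * beta T n * a)" using p(2) by (intro mult_pos_pos[OF _ qa]) auto
    then show ?thesis using True by simp
  next
    case False
    then have "b * ?w > 0" using b w by (intro mult_pos_pos) auto
    moreover have "alpha T (Suc k) * (T * beta T n * a - alpha T n * b) \<ge> 0"
      using p ab by (intro mult_nonneg_nonneg) auto
    ultimately show ?thesis by linarith
  qed
  ultimately have "0 < T * beta T n * (a * alpha T (Suc k) - b * beta T k)" by simp
  then have "0 < a * alpha T (Suc k) - b * beta T k"
    using q zero_less_mult_pos by blast
  then show ?thesis by simp
qed

text \<open>The functional of \<open>functional_pos\<close> takes the value 1 on the edge, hence the edge cannot
  contain a sum of two nonzero points of the cone.\<close>

lemma edge_irreducible:
  assumes "T > 0" "k < n" "0 \<le> t" "t \<le> T"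
  shows "irreducible_in_cone T n (alpha T k + t * beta T k) (T * beta T k + t * alpha T (Suc k))"
    (is "irreducible_in_cone T n ?X ?Y")
proof -
  have "in_cone T n ?X ?Y"
    using in_cone_combination[of T k n 1 t] assms by simp
  moreover have False
    if "in_cone T n a b" "in_cone T n (?X - a) (?Y - b)" "1 \<le> a" "a \<le> ?X - 1" for a b
  proof -
    have "a * alpha T (Suc k) - b * beta T k \<ge> 1"
      "(?X - a) * alpha T (Suc k) - (?Y - b) * beta T k \<ge> 1"
      using functional_pos assms that by auto
    moreover have "?X * alpha T (Suc k) - ?Y * beta T k = 1"
      using det_1[of T k] by (simp only: algebra_simps)
    ultimately show False by (simp only: algebra_simps)
  qed
  ultimately show ?thesis unfolding irreducible_in_cone_def by blast
qed

text \<open>The point lies in the sector between two consecutive vertices \<open>V_k\<close> and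
  \<open>V_(k+1)\<close>. There it has integer coordinates in the basis \<open>V_k\<close>,
  \<open>D_k\<close>, and if the first of them exceeds 1, a point of the edge can be split off. The
  bound on \<open>Y\<close> keeps the point off the ray of \<open>V_0\<close>.\<close>

lemma irreducible_edge:
  assumes "T > 0" "irreducible_in_cone T n X Y" "1 \<le> Y"
  obtains k t where "k < n" "0 \<le> t" "t \<le> T"
    "X = alpha T k + t * beta T k" "Y = T * beta T k + t * alpha T (Suc k)"
proof -
  have cone: "in_cone T n X Y" and irred:
    "\<And>a b. in_cone T n a b \<Longrightarrow> in_cone T n (X - a) (Y - b) \<Longrightarrow> 1 \<le> a \<Longrightarrow> a \<le> X - 1 \<Longrightarrow> False"
    using assms(2) unfolding irreducible_in_cone_def by blast+
  \<comment> \<open>\<open>P j\<close> says that the point is on or below the ray through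
    \<open>V_j\<close>; the least such \<open>j\<close> bounds its sector from above.\<close>
  define P where "P j \<longleftrightarrow> alpha T j * Y \<le> T * beta T j * X" for j
  have "\<not> P 0" "P n" using assms(3) cone by (auto simp: P_def in_cone_def)
  define j where "j = (LEAST j. P j)"
  have "P j" "\<And>i. i < j \<Longrightarrow> \<not> P i"
    using \<open>P n\<close> not_less_Least unfolding j_def by (auto intro: LeastI)
  have "j \<le> n" using \<open>P n\<close> unfolding j_def by (rule Least_le)
  obtain k where jk: "j = Suc k" using \<open>P j\<close> \<open>\<not> P 0\<close> by (cases j) auto
  have "P (Suc k)" "\<not> P k" "k < n" using \<open>P j\<close> \<open>\<And>i. i < j \<Longrightarrow> \<not> P i\<close> jk \<open>j \<le> n\<close> by auto
  \<comment> \<open>Cramer's rule for the basis \<open>V_k\<close>, \<open>D_k\<close>, whose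
    determinant is 1.\<close>
  define m t where "m = X * alpha T (Suc k) - Y * beta T k"
    and "t = alpha T k * Y - T * beta T k * X"
  have t0: "0 < t" using \<open>\<not> P k\<close> by (simp add: P_def t_def)
  have "T * m - t = T * beta T (Suc k) * X - alpha T (Suc k) * Y"
    by (simp add: m_def t_def alpha.simps beta.simps algebra_simps)
  then have tm: "t \<le> T * m" using \<open>P (Suc k)\<close> by (simp add: P_def)
  then have "0 < T * m" using t0 by linarith
  then have m0: "0 < m" using assms(1) zero_less_mult_pos by blast
  have "m * alpha T k + t * beta T k = X * (alpha T k * alpha T (Suc k) - T * beta T k * beta T k)"
    by (simp only: m_def t_def algebra_simps)
  then have X: "X = m * alpha T k + t * beta T k" by (simp only: det_1)
  have "m * (T * beta T k) + t * alpha T (Suc k)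
      = Y * (alpha T k * alpha T (Suc k) - T * beta T k * beta T k)"
    by (simp only: m_def t_def algebra_simps)
  then have Y: "Y = m * (T * beta T k) + t * alpha T (Suc k)" by (simp only: det_1)
  have "m = 1"
  proof (rule ccontr)
    assume "m \<noteq> 1"
    \<comment> \<open>The summand is \<open>V_k + s * D_k\<close>, as far along the edge as
      \<open>t\<close> permits; the rest has coordinates \<open>m - 1\<close> and
      \<open>t - s\<close> and still lies in the sector.\<close>
    define s where "s = min t T"
    have s: "0 \<le> s" "s \<le> T" "0 \<le> t - s" using assms(1) t0 by (auto simp: s_def)
    have st: "t - s \<le> T * (m - 1)"
    proof (cases "t \<le> T")
      case True
      then show ?thesis using assms(1) m0 by (auto simp: s_def)
    next
      case False
      then show ?thesis using tm by (auto simp: s_def algebra_simps)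
    qed
    let ?a = "1 * alpha T k + s * beta T k" and ?b = "1 * (T * beta T k) + s * alpha T (Suc k)"
    have a: "in_cone T n ?a ?b"
      using s assms(1) \<open>k < n\<close> by (intro in_cone_combination) auto
    have Xa: "X - ?a = (m - 1) * alpha T k + (t - s) * beta T k"
      and Yb: "Y - ?b = (m - 1) * (T * beta T k) + (t - s) * alpha T (Suc k)"
      by (simp_all only: X Y algebra_simps)
    have b: "in_cone T n (X - ?a) (Y - ?b)"
      unfolding Xa Yb using s st m0 assms(1) \<open>k < n\<close> by (intro in_cone_combination) auto
    have pos: "alpha T k \<ge> 1" "beta T k \<ge> 0" using alpha_pos beta_nonneg assms(1) by simp_all
    have "1 \<le> ?a" using pos s(1) by (simp add: add_increasing2)
    have "m - 1 \<ge> 1" using m0 \<open>m \<noteq> 1\<close> by simp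
    then have "(m - 1) * alpha T k \<ge> 1 * 1" using pos by (intro mult_mono) auto
    then have "X - ?a \<ge> 1" unfolding Xa using pos s(3) by (simp add: add_increasing2)
    then show False using irred[OF a b \<open>1 \<le> ?a\<close>] by simp
  qed
  then show ?thesis using that[of k t] \<open>k < n\<close> t0 tm X Y by simp
qed

text \<open>One number isolates the interior of edge k. The previous edge ends at height
  \<open>T * beta T k\<close>, below \<open>alpha T (Suc k) = alpha T k + T * beta T k\<close>; the
  next one starts at height \<open>T * beta T k + T * alpha T (Suc k)\<close>; and on edge k itself
  the position \<open>T - 1\<close> has height
  \<open>T * alpha T (Suc k) - alpha T k\<close>.\<close>

lemma irreducible_in_strip_iff:
  assumes "T > 0" "k < n"
  shows "irreducible_in_cone T n X Y \<and> alpha T (Suc k) \<le> Y \<and> Y < T * alpha T (Suc k) \<longleftrightarrow>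
    (\<exists>t. 1 \<le> t \<and> t < T \<and> X = alpha T k + t * beta T k \<and> Y = T * beta T k + t * alpha T (Suc k))"
    (is "?L \<longleftrightarrow> ?R")
proof
  assume ?L
  have A: "alpha T i \<ge> 1" "beta T i \<ge> 0" for i using alpha_pos beta_nonneg assms(1) by simp_all
  obtain j t where j: "j < n" "0 \<le> t" "t \<le> T"
    and X: "X = alpha T j + t * beta T j" and Y: "Y = T * beta T j + t * alpha T (Suc j)"
    using irreducible_edge[OF assms(1)] \<open>?L\<close> A(1)[of "Suc k"] by (metis order_trans)
  have "\<not> j < k"
  proof
    assume "j < k"
    then have "T * beta T (Suc j) \<le> T * beta T k" using assms(1) by (intro mult_left_mono beta_mono) auto
    moreover have "t * alpha T (Suc j) \<le> T * alpha T (Suc j)" using j A[of "Suc j"] by (intro mult_right_mono) auto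
    ultimately have "Y \<le> T * beta T k" unfolding Y beta_Suc by (simp only: algebra_simps)
    then show False using \<open>?L\<close> A(1)[of k] by (simp add: alpha.simps)
  qed
  moreover have "\<not> k < j"
  proof
    assume "k < j"
    then have "T * beta T (Suc k) \<le> T * beta T j" using assms(1) by (intro mult_left_mono beta_mono) auto
    moreover have "0 \<le> t * alpha T (Suc j)" "0 \<le> T * beta T k" using j A[of "Suc j"] A[of k] assms(1) by auto
    ultimately have "T * alpha T (Suc k) \<le> Y" unfolding Y beta_Suc by (simp only: algebra_simps)
    then show False using \<open>?L\<close> by simp
  qed
  ultimately have jk: "j = k" by simp
  have "t < T"
  proof (rule ccontr)
    assume "\<not> t < T"
    then have "T * alpha T (Suc k) \<le> t * alpha T (Suc k)" using A[of "Suc k"] by (intro mult_right_mono) auto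
    moreover have "0 \<le> T * beta T k" using A[of k] assms(1) by auto
    ultimately have "T * alpha T (Suc k) \<le> Y" unfolding Y jk by linarith
    then show False using \<open>?L\<close> by simp
  qed
  moreover have "t \<noteq> 0"
  proof
    assume "t = 0"
    then show False using \<open>?L\<close> Y jk A(1)[of k] by (simp add: alpha.simps)
  qed
  ultimately have "1 \<le> t" "t < T" using j by auto
  then show ?R using X Y jk by blast
next
  assume ?R
  then obtain t where t: "1 \<le> t" "t < T"
    and X: "X = alpha T k + t * beta T k" and Y: "Y = T * beta T k + t * alpha T (Suc k)" by blast
  have A: "alpha T i \<ge> 1" "beta T i \<ge> 0" for i using alpha_pos beta_nonneg assms(1) by simp_all
  have "irreducible_in_cone T n X Y"
    unfolding X Y using t assms by (intro edge_irreducible) auto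
  moreover have "1 * alpha T (Suc k) \<le> t * alpha T (Suc k)" using t A[of "Suc k"] by (intro mult_right_mono) auto
  then have "alpha T (Suc k) \<le> Y" using assms(1) A(2)[of k] unfolding Y by (simp add: add_increasing)
  moreover have "t * alpha T (Suc k) \<le> (T - 1) * alpha T (Suc k)"
    using t A[of "Suc k"] by (intro mult_right_mono) auto
  then have "Y < T * alpha T (Suc k)"
    using A(1)[of k] alpha.simps(2)[of T k] unfolding Y by (simp add: algebra_simps)
  ultimately show ?L by simp
qed

section \<open>Residues of the edge points modulo \<open>T\<close> and modulo
  \<open>2 * T - 1\<close>\<close>

lemma alpha_cong_1: "[alpha T k = 1] (mod T)"
  by (induction k) (auto simp: alpha.simps cong_iff_dvd_diff algebra_simps)

lemma edge_cong_mod_step: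
  "[T * beta T k + t * alpha T (Suc k) = t] (mod T)"
proof -
  have "[T * beta T k + t * alpha T (Suc k) = 0 + t * 1] (mod T)"
    by (intro cong_add cong_mult cong_refl alpha_cong_1) (simp add: cong_0_iff)
  then show ?thesis by simp
qed

text \<open>The sum is the left eigenvector for the eigenvalue 2: one round turns it into
  \<open>2 * alpha + (2 * T + 1) * beta\<close>, and \<open>2 * T + 1\<close> is 2 for this
  modulus.\<close>

lemma alpha_beta_cong_power: "[alpha T k + beta T k = 2 ^ k] (mod (2 * T - 1))"
proof (induction k)
  case (Suc k)
  have "alpha T (Suc k) + beta T (Suc k) - 2 ^ Suc k
      = 2 * (alpha T k + beta T k - 2 ^ k) + (2 * T - 1) * beta T k"
    by (simp add: alpha.simps beta.simps algebra_simps)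
  moreover have "(2 * T - 1) dvd 2 * (alpha T k + beta T k - 2 ^ k) + (2 * T - 1) * beta T k"
    using Suc by (intro dvd_add dvd_mult dvd_triv_left) (simp add: cong_iff_dvd_diff)
  ultimately show ?case by (simp only: cong_iff_dvd_diff)
qed simp

text \<open>The weights 1 and 2 are chosen so that, by \<open>2 * T = 1\<close>, the form is
  \<open>alpha + beta\<close> on \<open>V_k\<close> and twice this on \<open>D_k\<close>.\<close>

lemma edge_cong_power:
  "[(alpha T k + t * beta T k) + 2 * (T * beta T k + t * alpha T (Suc k)) = 2 ^ k * (1 + 2 * t)]
    (mod (2 * T - 1))"
proof -
  have "(alpha T k + t * beta T k) + 2 * (T * beta T k + t * alpha T (Suc k)) - 2 ^ k * (1 + 2 * t)
    = (1 + 2 * t) * (alpha T k + beta T k - 2 ^ k) + (2 * T - 1) * ((1 + t) * beta T k)"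
    by (simp add: alpha.simps beta.simps algebra_simps)
  moreover have "(2 * T - 1) dvd (1 + 2 * t) * (alpha T k + beta T k - 2 ^ k) + (2 * T - 1) * ((1 + t) * beta T k)"
    using alpha_beta_cong_power[of T k] by (simp add: cong_iff_dvd_diff)
  ultimately show ?thesis by (simp only: cong_iff_dvd_diff)
qed

section \<open>The formula and its VC-dimension\<close>

lemma bit_iff_mod_ge:
  fixes s :: int
  shows "bit s j \<longleftrightarrow> 2 ^ j \<le> s mod 2 ^ Suc j"
proof -
  have "s mod 2 ^ Suc j = 2 ^ j * (s div 2 ^ j mod 2) + s mod 2 ^ j"
    using zmod_zmult2_eq[of 2 s "2 ^ j"] by (simp add: mult.commute)
  moreover have "0 \<le> s mod 2 ^ j" "s mod 2 ^ j < 2 ^ j" by simp_all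
  ultimately show ?thesis
    by (cases "odd (s div 2 ^ j)") (simp_all add: bit_iff_odd mod2_eq_if not_le)
qed

text \<open>Multiplication by \<open>2 ^ k\<close> modulo \<open>2 ^ (e + 1) - 1\<close> rotates the binary digits. The
  representatives are taken from \<open>{1..M}\<close>, so that the word with all digits 1 stays itself.\<close>

lemma rotation_top_digit_iff:
  fixes s r :: int and e k :: nat
  defines "T \<equiv> 2 ^ e" and "M \<equiv> 2 * 2 ^ e - 1"
  assumes s: "1 \<le> s" "s < 2 ^ Suc e" and k: "k \<le> e" and cong: "[r = 2 ^ k * s] (mod M)"
  shows "(\<exists>w. T \<le> r - M * w \<and> r - M * w \<le> M) \<longleftrightarrow> bit s (e - k)"
proof -
  \<comment> \<open>Cut \<open>s\<close> above digit \<open>j\<close>: the upper part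
    \<open>h\<close> has k digits, and rotation by k places moves it below \<open>l\<close>. The
    result \<open>u\<close> has as top digit that of \<open>l\<close>, which is digit
    \<open>j\<close> of \<open>s\<close>; it is congruent to \<open>2 ^ k * s\<close> because
    \<open>2 ^ Suc e\<close> is 1 modulo \<open>M\<close>.\<close>
  define j h l where "j = e - k" and "h = s div 2 ^ Suc j" and "l = s mod 2 ^ Suc j"
  define u where "u = h + 2 ^ k * l"
  have e: "e = k + j" using k by (simp add: j_def)
  have shl: "s = 2 ^ Suc j * h + l" by (simp add: h_def l_def)
  have l: "0 \<le> l" "l < 2 ^ Suc j" by (simp_all add: l_def)
  have h: "0 \<le> h" using s by (simp add: h_def pos_imp_zdiv_nonneg_iff)
  have "h < 2 ^ k"
  proof (rule ccontr)
    assume "\<not> h < 2 ^ k"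
    then have "2 ^ Suc j * 2 ^ k \<le> 2 ^ Suc j * h" by (intro mult_left_mono) auto
    moreover have "(2::int) ^ Suc e = 2 ^ Suc j * 2 ^ k" by (simp add: e power_add)
    ultimately show False using s l shl by linarith
  qed
  have "1 \<le> u"
  proof (cases "h = 0")
    case True
    then have "1 \<le> l" using s shl by simp
    then show ?thesis using True by (simp add: u_def) (metis add.commute add_0 zless_iff_Suc_zadd
        int_one_le_iff_zero_less zero_less_mult_iff zero_less_numeral zero_less_power)
  next
    case False
    then show ?thesis using h l by (simp add: u_def add_increasing2)
  qed
  have "(2::int) ^ k * l \<le> 2 ^ k * (2 ^ Suc j - 1)" using l by (intro mult_left_mono) auto
  then have "u \<le> M" using \<open>h < 2 ^ k\<close>
    by (simp add: u_def M_def e power_add algebra_simps)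
  have ge: "T \<le> u \<longleftrightarrow> 2 ^ j \<le> l"
  proof
    assume "T \<le> u"
    then have "(2::int) ^ k * 2 ^ j < 2 ^ k * (l + 1)"
      using \<open>h < 2 ^ k\<close> by (simp add: u_def T_def e power_add algebra_simps)
    then show "2 ^ j \<le> l" by (subst (asm) mult_less_cancel_left_pos) auto
  next
    assume "2 ^ j \<le> l"
    then have "(2::int) ^ k * 2 ^ j \<le> 2 ^ k * l" by (intro mult_left_mono) auto
    then show "T \<le> u" using h unfolding u_def T_def e power_add by linarith
  qed
  have "2 ^ k * s = u + M * h" by (subst shl) (simp add: u_def M_def e power_add algebra_simps)
  then have "[r = u] (mod M)" using cong by (simp add: cong_def)
  then have "M dvd r - u" by (simp add: cong_iff_dvd_diff)
  then obtain c where "r - u = M * c" by (rule dvdE)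
  then have c: "r = u + M * c" by simp
  have "T \<ge> 1" unfolding T_def by simp
  then have "M \<ge> 1" unfolding M_def T_def by linarith
  have "(\<exists>w. T \<le> r - M * w \<and> r - M * w \<le> M) \<longleftrightarrow> T \<le> u"
  proof
    assume "T \<le> u"
    then show "\<exists>w. T \<le> r - M * w \<and> r - M * w \<le> M"
      using c \<open>u \<le> M\<close> by (intro exI[of _ c]) simp
  next
    \<comment> \<open>The window from \<open>T\<close> to \<open>M\<close> is part of
      \<open>{1..M}\<close>, which has one representative of each residue; so the representative in
      the window is \<open>u\<close>.\<close>
    assume "\<exists>w. T \<le> r - M * w \<and> r - M * w \<le> M"
    then obtain w where w: "T \<le> u + M * (c - w)" "u + M * (c - w) \<le> M"
      unfolding c by (auto simp: algebra_simps)
    then have "M * (c - w) < M * 1" "M * (-1) < M * (c - w)"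
      using \<open>1 \<le> u\<close> \<open>u \<le> M\<close> \<open>1 \<le> T\<close> by linarith+
    moreover have "M > 0" using \<open>M \<ge> 1\<close> by simp
    ultimately have "c - w < 1" "-1 < c - w" using mult_less_cancel_left_pos by blast+
    then have "c - w = 0" by linarith
    then show "T \<le> u" using w by simp
  qed
  then show ?thesis using ge bit_iff_mod_ge[of s j] by (simp add: j_def l_def)
qed

lemma exists_bit_pattern:
  "\<exists>s::int. 0 \<le> s \<and> s < 2 ^ n \<and> (\<forall>i<n. bit s i \<longleftrightarrow> i \<in> B)"
proof (intro exI conjI allI impI)
  let ?s = "take_bit n (horner_sum of_bool 2 (map (\<lambda>i. i \<in> B) [0..<n])) :: int"
  show "0 \<le> ?s" "?s < 2 ^ n" by simp_all
  show "bit ?s i \<longleftrightarrow> i \<in> B" if "i < n" for i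
    using that by (simp add: bit_take_bit_iff bit_horner_sum_bit_iff)
qed

section \<open>The formula and the set that it shatters\<close>

text \<open>The variables 0, 1 are \<open>x\<close>, \<open>y\<close>; the existential ones are \<open>X\<close>, \<open>Y\<close>, \<open>z\<close>, \<open>w\<close>, and
  the universal ones, 6 and 7, are the summand \<open>(a, b)\<close> of a decomposition of \<open>(X, Y)\<close>.\<close>

definition psi :: "int \<Rightarrow> int \<Rightarrow> int \<Rightarrow> int \<Rightarrow> pa" where
  "psi p q T M =
    And (Ineq [(-q, 2), (p, 3)] 0)
   (And (Neg
      (And (Ineq [(-1, 7)] 0)
      (And (Ineq [(-q, 6), (p, 7)] 0)
      (And (Ineq [(1, 7), (-1, 3)] 0)
      (And (Ineq [(-q, 2), (q, 6), (p, 3), (-p, 7)] 0)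
      (And (Ineq [(-1, 6)] (-1))
           (Ineq [(1, 6), (-1, 2)] (-1))))))))
   (And (Ineq [(1, 0), (-1, 3)] 0)
   (And (Ineq [(1, 3), (-T, 0)] (-1))
   (And (Ineq [(1, 3), (-1, 1), (-T, 4)] 0)
   (And (Ineq [(-1, 3), (1, 1), (T, 4)] 0)
   (And (Ineq [(-1, 2), (-2, 3), (M, 5)] (-T))
        (Ineq [(1, 2), (2, 3), (-M, 5)] M)))))))"

text \<open>The index \<open>Suc d\<close> of the cone is the one that d rounds of the recursion
  reach from index 1, where the machine starts.\<close>

definition formula :: "nat \<Rightarrow> pa" where
  "formula d = (let T = 2 ^ Suc d in
    psi (alpha T (Suc d)) (T * beta T (Suc d)) T (2 * T - 1))"

abbreviation quantified_formula :: "nat \<Rightarrow> pa" where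
  "quantified_formula d \<equiv> Exs [2, 3, 4, 5] (Alls [6, 7] (formula d))"

lemma quantifier_free_formula: "quantifier_free (formula d)"
  by (simp add: formula_def psi_def quantifier_free_def Let_def)

lemma free_vars_quantified_formula: "free_vars (quantified_formula d) = {0, 1}"
  by (auto simp: formula_def psi_def Let_def)

lemma quantified_formula_in_Short_PA: "quantified_formula d \<in> Short_PA 8 13"
proof -
  have "card (free_vars (quantified_formula d)) = 2"
    unfolding free_vars_quantified_formula by simp
  moreover have "num_quants (quantified_formula d) = 6" "num_ineqs (quantified_formula d) = 13"
    by (simp_all add: formula_def psi_def Let_def)
  ultimately show ?thesis by (simp add: Short_PA_def)
qed

text \<open>\<open>psi\<close> has no atom for \<open>0 \<le> Y\<close>: with
  \<open>x \<ge> 1\<close> this follows from the strip condition \<open>x \<le> Y\<close>.\<close>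

lemma sat_quantified_formula:
  assumes "1 \<le> e 0" and T: "T = 2 ^ Suc d" and M: "M = 2 * T - 1"
  shows "sat (quantified_formula d) e \<longleftrightarrow>
    (\<exists>X Y. (irreducible_in_cone T (Suc d) X Y \<and> e 0 \<le> Y \<and> Y < T * e 0) \<and> [Y = e 1] (mod T) \<and>
      (\<exists>w. T \<le> X + 2 * Y - M * w \<and> X + 2 * Y - M * w \<le> M))"
proof -
  have *: "formula d = psi (alpha T (Suc d)) (T * beta T (Suc d)) T M"
    by (simp add: formula_def Let_def T M)
  let ?p = "alpha T (Suc d)" and ?q = "T * beta T (Suc d)"
  have irreducible: "irreducible_in_cone T (Suc d) X Y \<longleftrightarrow> ?p * Y \<le> ?q * X \<and>
      (\<forall>a\<ge>1. \<forall>b. ?q * a + (?p * Y - ?p * b) \<le> ?q * X \<longrightarrow> b \<le> Y \<longrightarrow> ?p * b \<le> ?q * a \<longrightarrow>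
        0 \<le> b \<longrightarrow> \<not> a - X \<le> -1)"
    if "e 0 \<le> Y" for X Y
  proof -
    have "in_cone T (Suc d) (X - a) (Y - b) \<longleftrightarrow> b \<le> Y \<and> ?q * a + (?p * Y - ?p * b) \<le> ?q * X" for a b
      by (auto simp: in_cone_def algebra_simps)
    then show ?thesis
      using that assms(1) by (auto simp: irreducible_in_cone_def in_cone_def[of T "Suc d" X Y]
          in_cone_def[of T "Suc d" a b for a b])
  qed
  have cong: "[Y = e (Suc 0)] (mod T) \<longleftrightarrow>
      (\<exists>z. Y + (- e (Suc 0) - T * z) \<le> 0 \<and> e (Suc 0) + T * z \<le> Y)" for Y
    unfolding cong_iff_dvd_diff dvd_def by (intro iff_exI) auto
  have window: "T \<le> X + 2 * Y - M * w \<and> X + 2 * Y - M * w \<le> M \<longleftrightarrow>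
      M * w - 2 * Y - X \<le> - T \<and> X + (2 * Y - M * w) \<le> M" for X Y w
    by auto
  have less: "Y < T * e 0 \<longleftrightarrow> Y - T * e 0 \<le> -1" for Y
    by auto
  show ?thesis
    by (simp add: psi_def *, intro iff_exI, simp only: conj_assoc cong window less)
      (auto simp: irreducible)
qed

text \<open>Modulo \<open>T\<close> the position on the edge must be \<open>y\<close> itself. The
  form \<open>X + 2 * Y\<close> is then \<open>2 ^ k * (1 + 2 * y)\<close> modulo \<open>M\<close>,
  that is, the d + 2 digits of \<open>1 + 2 * y\<close> rotated by k places, and the window tests
  the top digit.\<close>

lemma sat_quantified_formula_iff_bit:
  assumes T: "T = 2 ^ Suc d" and k: "k < d" and y: "1 \<le> y" "y < T"
    and e: "e 0 = alpha T (Suc k)" "e 1 = y"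
  shows "sat (quantified_formula d) e \<longleftrightarrow> bit y (d - k)"
proof -
  have T2: "T > 0" "T \<ge> 0" using T by auto
  define M where "M = 2 * T - 1"
  have edge: "(\<exists>w. T \<le> r - M * w \<and> r - M * w \<le> M) \<longleftrightarrow> bit y (d - k)"
    if "r = (alpha T k + y * beta T k) + 2 * (T * beta T k + y * alpha T (Suc k))" for r
  proof -
    have "[r = 2 ^ k * (1 + 2 * y)] (mod (2 * 2 ^ Suc d - 1))"
      using edge_cong_power[of T k y] unfolding that T .
    moreover have "1 + 2 * y < 2 ^ Suc (Suc d)" using y T by simp
    ultimately have "(\<exists>w. T \<le> r - M * w \<and> r - M * w \<le> M) \<longleftrightarrow> bit (1 + 2 * y) (Suc d - k)"
      using rotation_top_digit_iff[of "1 + 2 * y" "Suc d" k r] y k unfolding M_def T by simp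
    also have "\<dots> \<longleftrightarrow> bit y (d - k)"
      using k by (simp add: Suc_diff_le bit_Suc)
    finally show ?thesis .
  qed
  have residue: "t = y" if "[T * beta T k + t * alpha T (Suc k) = y] (mod T)" "1 \<le> t" "t < T" for t
  proof -
    have "[t = y] (mod T)" using edge_cong_mod_step[of T k t] that(1) by (metis cong_sym cong_trans)
    then show ?thesis using that y by (simp add: cong_def)
  qed
  have "e 0 \<ge> 1" using e alpha_pos T2 by simp
  then have "sat (quantified_formula d) e \<longleftrightarrow> (\<exists>X Y.
      (\<exists>t. 1 \<le> t \<and> t < T \<and> X = alpha T k + t * beta T k \<and> Y = T * beta T k + t * alpha T (Suc k)) \<and>
      [Y = y] (mod T) \<and> (\<exists>w. T \<le> X + 2 * Y - M * w \<and> X + 2 * Y - M * w \<le> M))"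
    using sat_quantified_formula[OF _ T M_def, of e] irreducible_in_strip_iff[OF T2(1), of k "Suc d"] k e
    by simp
  also have "\<dots> \<longleftrightarrow> bit y (d - k)"
    using residue edge edge_cong_mod_step[of T k y] y by blast
  finally show ?thesis .
qed

lemma VC_quantified_formula: "VC_pa [0] [1] (quantified_formula d) \<ge> enat d"
proof -
  define T :: int where "T = 2 ^ Suc d"
  have "T > 0" unfolding T_def by simp
  let ?x = "\<lambda>k. [alpha T (Suc k)]"
  let ?A = "?x ` {..<d}"
  have inj: "inj_on ?x {..<d}"
    using alpha_Suc_strict_mono[OF \<open>T > 0\<close>] by (intro linorder_inj_onI) (auto simp: neq_iff)
  have "shatters (pa_family [0] [1] (quantified_formula d)) ?A"
    unfolding shatters_def
  proof (intro allI impI)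
    fix B assume "B \<subseteq> ?A"
    \<comment> \<open>Edge k tests digit \<open>d - k\<close> of \<open>y\<close>, which is digit
      \<open>d - 1 - k\<close> of \<open>s\<close>: the digits are assigned to the edges in reverse
      order.\<close>
    obtain s :: int where s: "0 \<le> s" "s < 2 ^ d"
      and bit: "\<And>i. i < d \<Longrightarrow> bit s i \<longleftrightarrow> ?x (d - 1 - i) \<in> B"
      using exists_bit_pattern[of d "{i. ?x (d - 1 - i) \<in> B}"] by auto
    define y where "y = 1 + 2 * s"
    have y: "1 \<le> y" "y < T" using s by (auto simp: y_def T_def)
    have "?x k \<in> pa_set [0] [1] (quantified_formula d) [y] \<longleftrightarrow> ?x k \<in> B" if "k < d" for k
    proof -
      let ?e = "assign ([0] @ [1]) (?x k @ [y])"
      have "sat (quantified_formula d) ?e \<longleftrightarrow> bit y (d - k)"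
        using that y by (intro sat_quantified_formula_iff_bit[OF T_def]) (auto simp: assign_def)
      also have "d - k = Suc (d - 1 - k)" using that by simp
      also have "bit y \<dots> \<longleftrightarrow> bit s (d - 1 - k)" by (simp add: y_def bit_Suc)
      also have "\<dots> \<longleftrightarrow> ?x k \<in> B" using that bit by simp
      finally show ?thesis by (simp add: pa_set_def)
    qed
    then have "B = pa_set [0] [1] (quantified_formula d) [y] \<inter> ?A"
      using \<open>B \<subseteq> ?A\<close> by auto
    moreover have "pa_set [0] [1] (quantified_formula d) [y] \<in> pa_family [0] [1] (quantified_formula d)"
      unfolding pa_family_def by (intro CollectI exI[of _ "[y]"]) simp
    ultimately show "\<exists>S\<in>pa_family [0] [1] (quantified_formula d). B = S \<inter> ?A"
      by blast
  qed
  then have "VC_pa [0] [1] (quantified_formula d) \<ge> enat (card ?A)"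
    unfolding VC_pa_def VC_def by (intro SUP_upper) auto
  then show ?thesis by (simp add: card_image inj)
qed

section \<open>Binary addition\<close>

definition digit :: "bool \<Rightarrow> letter" where
  "digit b = (if b then D1 else D0)"

lemma digit_simps [simp]: "digit True = D1" "digit False = D0" "digit b \<noteq> Plus" "Plus \<noteq> digit b"
  "digit b = D1 \<longleftrightarrow> b" "D1 = digit b \<longleftrightarrow> b"
  by (auto simp: digit_def)

fun bits_val :: "bool list \<Rightarrow> int" where
  "bits_val [] = 0"
| "bits_val (b # bs) = of_bool b + 2 * bits_val bs"

lemma bits_val_pos: "bs \<noteq> [] \<Longrightarrow> last bs \<Longrightarrow> bits_val bs \<ge> 1"
  by (induction bs) (auto split: if_splits)

lemma bits_val_append: "bits_val (us @ vs) = bits_val us + 2 ^ length us * bits_val vs"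
  by (induction us) (auto simp: algebra_simps)

lemma bits_val_replicate: "bits_val (replicate n True) = 2 ^ n - 1" "bits_val (replicate n False) = 0"
  by (induction n) auto

lemma nat_word_bits:
  assumes "bs \<noteq> []" "last bs"
  shows "nat_word (nat (bits_val bs)) = rev (map digit bs)"
  using assms
proof (induction bs)
  case (Cons b bs)
  show ?case
  proof (cases "bs = []")
    case True
    then show ?thesis using Cons.prems by (subst nat_word.simps) auto
  next
    case False
    then have bs: "bits_val bs \<ge> 1" "nat_word (nat (bits_val bs)) = rev (map digit bs)"
      using Cons bits_val_pos[of bs] by auto
    let ?n = "nat (bits_val (b # bs))"
    have n: "?n = of_bool b + 2 * nat (bits_val bs)"
      using bs(1) by (simp add: nat_add_distrib nat_mult_distrib)
    then have "\<not> ?n < 2" "?n div 2 = nat (bits_val bs)" "even ?n \<longleftrightarrow> \<not> b"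
      using bs(1) by auto
    then show ?thesis
      using bs(2) by (subst nat_word.simps) (simp add: digit_def)
  qed
qed simp

lemma int_word_bits:
  assumes "bs \<noteq> []" "last bs"
  shows "int_word (bits_val bs) = rev (map digit bs)"
    "int_word (- bits_val bs) = Minus # rev (map digit bs)"
  using nat_word_bits[OF assms] bits_val_pos[OF assms] by (auto simp: int_word_def)

text \<open>The equations follow the loop of \<open>tm_add\<close>: it ends as soon as the second
  summand is used up and no carry is left, and the remaining digits of the first summand stay
  untouched.\<close>

fun add_bits :: "bool \<Rightarrow> bool list \<Rightarrow> bool list \<Rightarrow> bool list" where
  "add_bits False xs [] = xs"
| "add_bits True [] [] = [True]"
| "add_bits True (x # xs) [] = (\<not> x) # add_bits x xs []"
| "add_bits c [] (y # ys) = (y \<noteq> c) # add_bits (y \<and> c) [] ys"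
| "add_bits c (x # xs) (y # ys) = (x \<noteq> (y \<noteq> c)) # add_bits (x \<and> y \<or> x \<and> c \<or> y \<and> c) xs ys"

lemma bits_val_add_bits: "bits_val (add_bits c xs ys) = of_bool c + bits_val xs + bits_val ys"
  by (induction c xs ys rule: add_bits.induct) auto

lemma add_bits_Nil_Nil [simp]: "add_bits c [] [] = (if c then [True] else [])"
  by (cases c) auto

text \<open>A last entry \<open>True\<close> means that there is no leading zero, which makes the
  stored digits agree with \<open>int_word\<close>.\<close>

lemma add_bits_last:
  "xs = [] \<or> last xs \<Longrightarrow> ys = [] \<or> last ys \<Longrightarrow> c \<or> xs \<noteq> [] \<or> ys \<noteq> [] \<Longrightarrow>
    add_bits c xs ys \<noteq> [] \<and> last (add_bits c xs ys)"
  by (induction c xs ys rule: add_bits.induct) (auto split: if_splits)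

lemma length_add_bits: "length (add_bits c xs ys) \<le> Suc (max (length xs) (length ys))"
  by (induction c xs ys rule: add_bits.induct) auto

definition add_shifted :: "nat \<Rightarrow> bool list \<Rightarrow> bool list \<Rightarrow> bool list" where
  "add_shifted e xs ys = take e (xs @ replicate e False) @ add_bits False (drop e xs) ys"

lemma bits_val_add_shifted:
  "bits_val (add_shifted e xs ys) = bits_val xs + 2 ^ e * bits_val ys"
proof -
  have "bits_val xs = bits_val (xs @ replicate e False)"
    by (simp add: bits_val_append bits_val_replicate)
  also have "\<dots> = bits_val (take e (xs @ replicate e False) @ (drop e xs @ replicate (e - (e - length xs)) False))"
    by (subst append_take_drop_id[of e "xs @ replicate e False", symmetric]) (simp add: drop_replicate)
  also have "\<dots> = bits_val (take e (xs @ replicate e False)) + 2 ^ e * bits_val (drop e xs)"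
    by (subst bits_val_append) (simp add: bits_val_append bits_val_replicate min_def)
  finally have "bits_val xs = bits_val (take e (xs @ replicate e False)) + 2 ^ e * bits_val (drop e xs)" .
  moreover have "length (take e (xs @ replicate e False)) = e" by simp
  ultimately show ?thesis
    unfolding add_shifted_def bits_val_append bits_val_add_bits by (simp only: algebra_simps) simp
qed

text \<open>The start is index 1 of \<open>alpha\<close> and \<open>beta\<close>, both with value 1:
  at index 0, \<open>beta\<close> vanishes and has no leading digit 1.\<close>

fun bit_pairs :: "nat \<Rightarrow> nat \<Rightarrow> bool list \<times> bool list" where
  "bit_pairs e 0 = ([True], [True])"
| "bit_pairs e (Suc k) = (case bit_pairs e k of (a, b) \<Rightarrow>
     let a' = add_shifted e a b in (a', add_bits False b a'))"

text \<open>A round adds at most \<open>e + 1\<close> digits by the shifted addition and one more by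
  the plain addition; this is why the coefficients have quadratic length.\<close>

lemma bit_pairs:
  assumes "bit_pairs e k = (a, b)"
  shows "a \<noteq> [] \<and> last a \<and> b \<noteq> [] \<and> last b \<and>
    bits_val a = alpha (2 ^ e) (Suc k) \<and> bits_val b = beta (2 ^ e) (Suc k) \<and>
    length a \<le> 1 + k * (e + 2) \<and> length b \<le> 1 + k * (e + 2)"
  using assms
proof (induction k arbitrary: a b)
  case 0
  then show ?case by (auto simp: alpha.simps beta.simps)
next
  case (Suc k)
  obtain a0 b0 where ab0: "bit_pairs e k = (a0, b0)" by fastforce
  have a: "a = add_shifted e a0 b0" and b: "b = add_bits False b0 a"
    using Suc.prems ab0 by (auto simp: Let_def)
  note IH = Suc.IH[OF ab0]
  have "add_bits False (drop e a0) b0 \<noteq> [] \<and> last (add_bits False (drop e a0) b0)"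
    using IH by (intro add_bits_last) (cases "e < length a0"; auto)+
  then have al: "a \<noteq> []" "last a" unfolding a add_shifted_def by auto
  then have bl: "b \<noteq> [] \<and> last b" unfolding b using IH by (intro add_bits_last) auto
  have "length a \<le> e + Suc (max (length a0 - e) (length b0))"
    using length_add_bits[of False "drop e a0" b0] unfolding a add_shifted_def by simp
  moreover have "length b \<le> Suc (max (length b0) (length a))"
    unfolding b by (rule length_add_bits)
  moreover have "bits_val a = alpha (2 ^ e) (Suc (Suc k))"
    using IH by (simp add: a bits_val_add_shifted alpha.simps(2)[of _ "Suc k"])
  moreover from this have "bits_val b = beta (2 ^ e) (Suc (Suc k))"
    using IH by (simp add: b bits_val_add_bits beta_Suc[of _ "Suc k"])
  moreover have "length a0 \<le> 1 + k * (e + 2)" "length b0 \<le> 1 + k * (e + 2)"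
    using IH by blast+
  then have "length a \<le> 1 + k * (e + 2) + (e + 1)" "length b \<le> 1 + k * (e + 2) + (e + 2)"
    using \<open>length a \<le> _\<close> \<open>length b \<le> _\<close> by linarith+
  ultimately show ?case using al bl by (simp add: algebra_simps)
qed

section \<open>Composing Turing machines\<close>

definition scan :: "tape list \<Rightarrow> letter option list" where
  "scan = map (\<lambda>(f, h). f h)"

definition idle :: "letter option list \<Rightarrow> nat \<Rightarrow> letter option \<times> move" where
  "idle s = (\<lambda>i. (s ! i, MStay))"

definition act_tapes :: "(nat \<Rightarrow> letter option \<times> move) \<Rightarrow> tape list \<Rightarrow> tape list" where
  "act_tapes g ts = map (\<lambda>i. update_tape (g i) (ts ! i)) [0..<length ts]"

lemma length_scan [simp]: "length (scan ts) = length ts"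
  by (simp add: scan_def)

lemma nth_scan [simp]: "i < length ts \<Longrightarrow> scan ts ! i = (case ts ! i of (f, h) \<Rightarrow> f h)"
  by (simp add: scan_def)

lemma act_tapes_idle [simp]: "act_tapes (idle (scan ts)) ts = ts"
  by (rule nth_equalityI) (auto simp: act_tapes_def idle_def split: prod.split)

lemma act_tapes_upd [simp]:
  "act_tapes (g(i := w)) ts = (act_tapes g ts)[i := update_tape w (ts ! i)]"
  by (rule nth_equalityI) (auto simp: act_tapes_def nth_list_update)

lemma tm_step_act:
  "q < length M \<Longrightarrow> tm_step M (q, ts) =
    (fst ((M ! q) (scan ts)), act_tapes (snd ((M ! q) (scan ts))) ts)"
  by (simp add: scan_def act_tapes_def split: prod.split)

text \<open>A zipper: the part left of the head is reversed, so that head moves act on the fronts of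
  two lists. An empty right part means that a blank is scanned.\<close>

definition tape_at :: "letter list \<Rightarrow> letter list \<Rightarrow> tape" where
  "tape_at l r = (tape_contents (rev l @ r), length l)"

lemma tape_contents_upd:
  "(tape_contents (u @ x # v))(length u := Some y) = tape_contents (u @ y # v)"
  "(tape_contents u)(length u := Some y) = tape_contents (u @ [y])"
  "(tape_contents u)(length u := None) = tape_contents u"
  by (auto simp: tape_contents_def nth_append nth_Cons fun_eq_iff split: nat.split)

lemma update_tape_at [simp]:
  "update_tape (Some y, MStay) (tape_at l (x # r)) = tape_at l (y # r)"
  "update_tape (Some y, MStay) (tape_at l []) = tape_at l [y]"
  "update_tape (None, MStay) (tape_at l []) = tape_at l []"
  "update_tape (Some y, MRight) (tape_at l (x # r)) = tape_at (y # l) r"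
  "update_tape (Some y, MRight) (tape_at l []) = tape_at (y # l) []"
  "update_tape (Some y, MLeft) (tape_at (z # l) (x # r)) = tape_at l (z # y # r)"
  "update_tape (None, MLeft) (tape_at (z # l) []) = tape_at l [z]"
  "update_tape (Some y, MLeft) (tape_at [] (x # r)) = tape_at [] (y # r)"
  "update_tape (None, MLeft) (tape_at [] []) = tape_at [] []"
  using tape_contents_upd[of "rev l"] tape_contents_upd[of "rev l @ [z]"] tape_contents_upd(1,3)[of "[]"]
  by (auto simp: tape_at_def simp del: fun_upd_apply)

lemma read_tape_at [simp]:
  "(case tape_at l [] of (f, h) \<Rightarrow> f h) = None"
  "(case tape_at l (x # r) of (f, h) \<Rightarrow> f h) = Some x"
  by (auto simp: tape_at_def tape_contents_def nth_append)

text \<open>Machines are composed from fragments that start in state 0 and leave through the first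
  state after their last row.\<close>

definition tm_runs :: "tm \<Rightarrow> nat \<Rightarrow> tape list \<Rightarrow> tape list \<Rightarrow> bool" where
  "tm_runs M n ts ts' \<longleftrightarrow> (\<exists>m\<le>n. (tm_step M ^^ m) (0, ts) = (length M, ts'))"

definition tm_shift :: "nat \<Rightarrow> tm \<Rightarrow> tm" where
  "tm_shift n = map (\<lambda>row s. apfst (\<lambda>q. n + q) (row s))"

definition tm_seq :: "tm \<Rightarrow> tm \<Rightarrow> tm"  (infixr "\<Zsemi>" 65) where
  "M \<Zsemi> N = M @ tm_shift (length M) N"

definition tm_act :: "(letter option list \<Rightarrow> nat \<Rightarrow> letter option \<times> move) \<Rightarrow> tm" where
  "tm_act g = [\<lambda>s. (1, g s)]"

definition tm_while :: "(letter option list \<Rightarrow> bool) \<Rightarrow> tm \<Rightarrow> tm" where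
  "tm_while c M = (\<lambda>s. (if c s then 1 else length M + 2, idle s)) # tm_shift 1 M @ [\<lambda>s. (0, idle s)]"

lemma length_tm_shift [simp]: "length (tm_shift n M) = length M"
  by (simp add: tm_shift_def)

lemma tm_runs_mono: "tm_runs M n ts ts' \<Longrightarrow> n \<le> n' \<Longrightarrow> tm_runs M n' ts ts'"
  unfolding tm_runs_def using order_trans by blast

text \<open>The exit state of \<open>M\<close> is halting in \<open>M\<close> but may have a row in
  \<open>N\<close>. The run of \<open>M\<close> may idle there for the rest of its \<open>m\<close>
  steps, whereas that of \<open>N\<close> has to be stopped on arrival; hence only
  \<open>m' \<le> m\<close>.\<close>

lemma tm_steps_embedded:
  assumes "\<And>i. i < length M \<Longrightarrow> k + i < length N \<and> N ! (k + i) = (\<lambda>s. apfst (\<lambda>q. k + q) ((M ! i) s))"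
    and "(tm_step M ^^ m) (q, ts) = (length M, ts')"
  shows "\<exists>m'\<le>m. (tm_step N ^^ m') (k + q, ts) = (k + length M, ts')"
  using assms(2)
proof (induction m arbitrary: q ts)
  case (Suc m)
  show ?case
  proof (cases "q < length M")
    case True
    let ?q = "fst ((M ! q) (scan ts))" and ?ts = "act_tapes (snd ((M ! q) (scan ts))) ts"
    have "(tm_step M ^^ m) (?q, ?ts) = (length M, ts')"
      using Suc.prems True by (simp add: funpow_Suc_right tm_step_act del: funpow.simps tm_step.simps)
    then obtain m' where "m' \<le> m" "(tm_step N ^^ m') (k + ?q, ?ts) = (k + length M, ts')"
      using Suc.IH by blast
    moreover have "tm_step N (k + q, ts) = (k + ?q, ?ts)"
      using assms(1)[OF True] by (simp add: tm_step_act apfst_def map_prod_def split_beta del: tm_step.simps)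
    ultimately have "Suc m' \<le> Suc m \<and> (tm_step N ^^ Suc m') (k + q, ts) = (k + length M, ts')"
      by (simp add: funpow_Suc_right del: funpow.simps tm_step.simps)
    then show ?thesis by blast
  next
    case False
    then have "tm_step M (q, ts) = (q, ts)" by simp
    then have "(tm_step M ^^ Suc m) (q, ts) = (q, ts)"
      by (induction m) (auto simp del: tm_step.simps)
    then show ?thesis using Suc.prems by (intro exI[of _ 0]) simp
  qed
qed auto

lemma tm_runs_embedded:
  assumes "tm_runs M n ts ts'"
    and "\<And>i. i < length M \<Longrightarrow> k + i < length N \<and> N ! (k + i) = (\<lambda>s. apfst (\<lambda>q. k + q) ((M ! i) s))"
  shows "\<exists>m\<le>n. (tm_step N ^^ m) (k, ts) = (k + length M, ts')"
proof -
  obtain m where m: "m \<le> n" "(tm_step M ^^ m) (0, ts) = (length M, ts')"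
    using assms(1) by (auto simp: tm_runs_def)
  then obtain m' where "m' \<le> m" "(tm_step N ^^ m') (k + 0, ts) = (k + length M, ts')"
    using tm_steps_embedded[OF assms(2) m(2)] by blast
  then show ?thesis using m(1) by (intro exI[of _ m']) auto
qed

lemma tm_runs_seq:
  assumes "tm_runs M m ts ts'" "tm_runs N n ts' ts''"
  shows "tm_runs (M \<Zsemi> N) (m + n) ts ts''"
proof -
  obtain i where i: "i \<le> m" "(tm_step (M \<Zsemi> N) ^^ i) (0, ts) = (length M, ts')"
    using tm_runs_embedded[OF assms(1), of 0 "M \<Zsemi> N"]
    by (auto simp: tm_seq_def nth_append apfst_def map_prod_def split_beta)
  obtain j where j: "j \<le> n" "(tm_step (M \<Zsemi> N) ^^ j) (length M, ts') = (length M + length N, ts'')"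
    using tm_runs_embedded[OF assms(2), of "length M" "M \<Zsemi> N"]
    by (auto simp: tm_seq_def nth_append tm_shift_def)
  have "(tm_step (M \<Zsemi> N) ^^ (j + i)) (0, ts) = (length (M \<Zsemi> N), ts'')"
    using i j by (simp add: funpow_add) (simp add: tm_seq_def)
  then show ?thesis using i(1) j(1) unfolding tm_runs_def by (intro exI[of _ "j + i"]) simp
qed

lemma tm_runs_act: "ts' = act_tapes (g (scan ts)) ts \<Longrightarrow> tm_runs (tm_act g) 1 ts ts'"
  unfolding tm_runs_def
  by (intro exI[of _ 1]) (simp add: tm_act_def tm_step_act del: tm_step.simps)

lemma tm_runs_while_stop: "\<not> c (scan ts) \<Longrightarrow> tm_runs (tm_while c M) 1 ts ts"
  unfolding tm_runs_def
  by (intro exI[of _ 1]) (simp add: tm_while_def tm_step_act del: tm_step.simps)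

lemma tm_runs_while_step:
  assumes "c (scan ts)" "tm_runs M m ts ts'" "tm_runs (tm_while c M) n ts' ts''"
  shows "tm_runs (tm_while c M) (m + 2 + n) ts ts''"
proof -
  let ?N = "tm_while c M"
  have first: "tm_step ?N (0, ts) = (1, ts)"
    using assms(1) by (simp add: tm_while_def tm_step_act del: tm_step.simps)
  obtain i where i: "i \<le> m" "(tm_step ?N ^^ i) (1, ts) = (1 + length M, ts')"
    using tm_runs_embedded[OF assms(2), of 1 ?N]
    by (auto simp: tm_while_def nth_append tm_shift_def)
  have last: "tm_step ?N (1 + length M, ts') = (0, ts')"
    by (simp add: tm_while_def tm_step_act nth_append del: tm_step.simps)
  obtain j where j: "j \<le> n" "(tm_step ?N ^^ j) (0, ts') = (length ?N, ts'')"
    using assms(3) by (auto simp: tm_runs_def)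
  have "(tm_step ?N ^^ (j + Suc (i + Suc 0))) (0, ts) = (length ?N, ts'')"
    using first i last j by (simp only: funpow_add funpow.simps o_apply id_apply)
  then show ?thesis using i(1) j(1) unfolding tm_runs_def by (intro exI[of _ "j + Suc (i + Suc 0)"]) simp
qed

lemma tm_runs_while_iterate:
  assumes "\<And>i. i < n \<Longrightarrow> c (scan (f i)) \<and> tm_runs M m (f i) (f (Suc i))" "\<not> c (scan (f n))"
  shows "tm_runs (tm_while c M) (n * (m + 2) + 1) (f 0) (f n)"
  using assms
proof (induction n arbitrary: f)
  case 0
  then show ?case using tm_runs_while_stop[of c "f 0" M] by simp
next
  case (Suc n)
  have "tm_runs (tm_while c M) (n * (m + 2) + 1) (f (Suc 0)) (f (Suc n))"
    using Suc.IH[of "\<lambda>i. f (Suc i)"] Suc.prems by auto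
  then have "tm_runs (tm_while c M) (m + 2 + (n * (m + 2) + 1)) (f 0) (f (Suc n))"
    using Suc.prems(1)[of 0] by (intro tm_runs_while_step) auto
  then show ?case by (simp add: algebra_simps)
qed

section \<open>Loops of the machine\<close>

text \<open>The three steps are the test, the action and the jump back.\<close>

lemma tm_runs_while_act:
  assumes "c (scan ts)" "ts' = act_tapes (g (scan ts)) ts" "tm_runs (tm_while c (tm_act g)) n ts' ts''"
  shows "tm_runs (tm_while c (tm_act g)) (n + 3) ts ts''"
proof -
  have "tm_runs (tm_act g) 1 ts ts'" using assms(2) by (rule tm_runs_act)
  from tm_runs_while_step[of c, OF assms(1) this assms(3)] show ?thesis
    by (simp add: eval_nat_numeral)
qed

lemma nth_list_update_if: "n < length xs \<Longrightarrow> xs[i := x] ! n = (if n = i then x else xs ! n)"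
  by (simp add: nth_list_update)

lemma list_update_twice:
  "i \<noteq> j \<Longrightarrow> xs[i := a, j := b, i := a', j := b'] = xs[i := a', j := b']"
  "distinct [i, j, k] \<Longrightarrow>
    xs[i := a, j := b, k := c, i := a', j := b', k := c'] = xs[i := a', j := b', k := c']"
  by (auto intro!: nth_equalityI simp: nth_list_update_if)

text \<open>The left end of a tape cannot be sensed, so the letter \<open>Plus\<close>, which is no
  digit, serves as a marker in cell 0.\<close>

definition rewind :: "nat \<Rightarrow> tm" where
  "rewind i = tm_while (\<lambda>s. s ! i \<noteq> Some Plus) (tm_act (\<lambda>s. (idle s)(i := (s ! i, MLeft))))"

lemma tm_runs_rewind:
  assumes "i < length ts" "ts ! i = tape_at (ys @ [Plus]) r" "Plus \<notin> set ys" "Plus \<notin> set r"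
  shows "tm_runs (rewind i) (3 * length ys + 4) ts (ts[i := tape_at [] (Plus # rev ys @ r)])"
  using assms
proof (induction ys arbitrary: ts r)
  case Nil
  let ?ts = "ts[i := tape_at [] (Plus # r)]"
  have "tm_runs (rewind i) (1 + 3) ts ?ts"
    unfolding rewind_def
    by (rule tm_runs_while_act[OF _ _ tm_runs_while_stop]) (use Nil in \<open>cases r; auto\<close>)+
  then show ?case by simp
next
  case (Cons y ys)
  let ?ts = "ts[i := tape_at (ys @ [Plus]) (y # r)]"
  have "tm_runs (rewind i) (3 * length ys + 4) ?ts (?ts[i := tape_at [] (Plus # rev ys @ y # r)])"
    using Cons.prems by (intro Cons.IH) auto
  then have "tm_runs (rewind i) (3 * length ys + 4 + 3) ts (?ts[i := tape_at [] (Plus # rev ys @ y # r)])"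
    unfolding rewind_def
    by (rule tm_runs_while_act[rotated 2]) (use Cons.prems in \<open>cases r; auto\<close>)+
  then show ?case by simp
qed

text \<open>Rewinding tape \<open>i\<close> while appending what is read to the output tape reverses the word, so
  that a number stored with its least significant digit first is written most significant digit first.\<close>

definition rewind_emit :: "nat \<Rightarrow> tm" where
  "rewind_emit i = tm_while (\<lambda>s. s ! i \<noteq> Some Plus)
    (tm_act (\<lambda>s. (idle s)(i := (s ! i, MLeft), 1 := (s ! i, if s ! i = None then MStay else MRight))))"

text \<open>A rewind begins on a blank, but after one move left the head scans a symbol not yet
  copied; the term with \<open>take 1 r\<close> covers both situations in one induction.\<close>

lemma tm_runs_rewind_emit:
  assumes "i < length ts" "1 < length ts" "i \<noteq> 1" "ts ! i = tape_at (ys @ [Plus]) r" "ts ! 1 = tape_at out []"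
    "Plus \<notin> set ys" "Plus \<notin> set r"
  shows "tm_runs (rewind_emit i) (3 * length ys + 4) ts
    (ts[i := tape_at [] (Plus # rev ys @ r), 1 := tape_at (rev ys @ rev (take 1 r) @ out) []])"
  using assms
proof (induction ys arbitrary: ts r out)
  case Nil
  let ?ts = "ts[i := tape_at [] (Plus # r), 1 := tape_at (rev (take 1 r) @ out) []]"
  have "tm_runs (rewind_emit i) (1 + 3) ts ?ts"
    unfolding rewind_emit_def
    by (rule tm_runs_while_act[OF _ _ tm_runs_while_stop]) (use Nil in \<open>cases r; auto simp: list_update_swap\<close>)+
  then show ?case by simp
next
  case (Cons y ys)
  let ?ts = "ts[i := tape_at (ys @ [Plus]) (y # r), 1 := tape_at (rev (take 1 r) @ out) []]"
  have "tm_runs (rewind_emit i) (3 * length ys + 4) ?ts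
    (?ts[i := tape_at [] (Plus # rev ys @ y # r), 1 := tape_at (rev ys @ rev (take 1 (y # r)) @ rev (take 1 r) @ out) []])"
    using Cons.prems by (intro Cons.IH) auto
  then have "tm_runs (rewind_emit i) (3 * length ys + 4 + 3) ts
    (?ts[i := tape_at [] (Plus # rev ys @ y # r), 1 := tape_at (rev ys @ rev (take 1 (y # r)) @ rev (take 1 r) @ out) []])"
    unfolding rewind_emit_def
    by (rule tm_runs_while_act[rotated 2]) (use Cons.prems in \<open>cases r; auto simp: list_update_swap\<close>)+
  then show ?case using Cons.prems by (simp add: list_update_twice)
qed

definition run_right :: "nat \<Rightarrow> tm" where
  "run_right i = tm_while (\<lambda>s. s ! i \<noteq> None) (tm_act (\<lambda>s. (idle s)(i := (s ! i, MRight))))"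

lemma tm_runs_run_right:
  assumes "i < length ts" "ts ! i = tape_at l r"
  shows "tm_runs (run_right i) (3 * length r + 1) ts (ts[i := tape_at (rev r @ l) []])"
  using assms
proof (induction r arbitrary: ts l)
  case Nil
  then have "ts[i := tape_at l []] = ts" by (metis list_update_id)
  moreover have "tm_runs (run_right i) 1 ts ts"
    unfolding run_right_def by (rule tm_runs_while_stop) (use Nil in simp)
  ultimately show ?case by simp
next
  case (Cons x r)
  let ?ts = "ts[i := tape_at (x # l) r]"
  have "tm_runs (run_right i) (3 * length r + 1) ?ts (?ts[i := tape_at (rev r @ x # l) []])"
    using Cons.prems by (intro Cons.IH) auto
  then have "tm_runs (run_right i) (3 * length r + 1 + 3) ts (?ts[i := tape_at (rev r @ x # l) []])"
    unfolding run_right_def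
    by (rule tm_runs_while_act[rotated 2]) (use Cons.prems in auto)
  then show ?case by simp
qed

text \<open>The carry is kept on tape 4.\<close>

definition tm_add :: "nat \<Rightarrow> nat \<Rightarrow> tm" where
  "tm_add i j = tm_while (\<lambda>s. s ! j \<noteq> None \<or> s ! 4 = Some D1)
    (tm_act (\<lambda>s. let x = s ! i = Some D1; y = s ! j = Some D1; c = s ! 4 = Some D1 in (idle s)
      (i := (Some (digit (x \<noteq> (y \<noteq> c))), MRight),
       j := (s ! j, if s ! j = None then MStay else MRight),
       4 := (Some (digit (x \<and> y \<or> x \<and> c \<or> y \<and> c)), MStay))))"

text \<open>The sum overwrites the first summand. The head stops where the loop ends, which need not
  be the end of the sum, so the sum is split at an unspecified place; the rewinding that follows
  makes the place immaterial.\<close>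

lemma tm_runs_add:
  assumes "i < length ts" "j < length ts" "4 < length ts" "distinct [i, j, 4]"
    "ts ! i = tape_at l (map digit xs)" "ts ! j = tape_at l' (map digit ys)" "ts ! 4 = tape_at [] [digit c]"
  shows "\<exists>us vs. us @ vs = add_bits c xs ys \<and> tm_runs (tm_add i j) (3 * (length xs + length ys) + 4) ts
    (ts[i := tape_at (rev (map digit us) @ l) (map digit vs), j := tape_at (rev (map digit ys) @ l') [],
      4 := tape_at [] [D0]])"
  using assms
proof (induction c xs ys arbitrary: ts l l' rule: add_bits.induct)
  case (1 xs)
  then have "ts[i := tape_at l (map digit xs), j := tape_at l' [], 4 := tape_at [] [D0]] = ts"
    by (metis digit_simps(2) list.map(1) list_update_id)
  moreover have "tm_runs (tm_add i j) 1 ts ts"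
    unfolding tm_add_def by (rule tm_runs_while_stop) (use 1 in simp)
  ultimately show ?case
    by (intro exI[of _ "[]"] exI[of _ xs]) (auto elim: tm_runs_mono)
next
  case 2
  have "tm_runs (tm_add i j) (1 + 3) ts
    (ts[i := tape_at (D1 # l) [], j := tape_at l' [], 4 := tape_at [] [D0]])"
    unfolding tm_add_def
    by (rule tm_runs_while_act[OF _ _ tm_runs_while_stop]) (use 2 in \<open>auto simp: Let_def\<close>)+
  then show ?case
    by (intro exI[of _ "[True]"] exI[of _ "[]"]) simp
next
  case (3 x xs)
  let ?ts = "ts[i := tape_at (digit (\<not> x) # l) (map digit xs), j := tape_at l' [], 4 := tape_at [] [digit x]]"
  obtain us vs where us: "us @ vs = add_bits x xs []" and run: "tm_runs (tm_add i j) (3 * (length xs + 0) + 4) ?ts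
    (?ts[i := tape_at (rev (map digit us) @ digit (\<not> x) # l) (map digit vs), j := tape_at l' [], 4 := tape_at [] [D0]])"
    (is "tm_runs _ _ _ ?t") using "3.IH"[of ?ts "digit (\<not> x) # l" l'] "3.prems" by auto
  from run have "tm_runs (tm_add i j) (3 * (length xs + 0) + 4 + 3) ts ?t"
    unfolding tm_add_def
    by (rule tm_runs_while_act[rotated 2]) (use "3.prems" in \<open>auto simp: Let_def\<close>)+
  then show ?case using us "3.prems"
    by (intro exI[of _ "(\<not> x) # us"] exI[of _ vs]) (simp add: list_update_twice)
next
  case (4 c y ys)
  let ?ts = "ts[i := tape_at (digit (y \<noteq> c) # l) [], j := tape_at (digit y # l') (map digit ys),
    4 := tape_at [] [digit (y \<and> c)]]"
  obtain us vs where us: "us @ vs = add_bits (y \<and> c) [] ys" and run: "tm_runs (tm_add i j) (3 * (0 + length ys) + 4) ?ts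
    (?ts[i := tape_at (rev (map digit us) @ digit (y \<noteq> c) # l) (map digit vs),
      j := tape_at (rev (map digit ys) @ digit y # l') [], 4 := tape_at [] [D0]])"
    (is "tm_runs _ _ _ ?t") using "4.IH"[of ?ts "digit (y \<noteq> c) # l" "digit y # l'"] "4.prems" by auto
  from run have "tm_runs (tm_add i j) (3 * (0 + length ys) + 4 + 3) ts ?t"
    unfolding tm_add_def
    by (rule tm_runs_while_act[rotated 2]) (use "4.prems" in \<open>auto simp: Let_def\<close>)+
  then show ?case using us "4.prems"
    by (intro exI[of _ "(y \<noteq> c) # us"] exI[of _ vs]) (simp add: list_update_twice)
next
  case (5 c x xs y ys)
  let ?z = "x \<noteq> (y \<noteq> c)" and ?c = "x \<and> y \<or> x \<and> c \<or> y \<and> c"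
  let ?ts = "ts[i := tape_at (digit ?z # l) (map digit xs), j := tape_at (digit y # l') (map digit ys),
    4 := tape_at [] [digit ?c]]"
  obtain us vs where us: "us @ vs = add_bits ?c xs ys" and run: "tm_runs (tm_add i j) (3 * (length xs + length ys) + 4) ?ts
    (?ts[i := tape_at (rev (map digit us) @ digit ?z # l) (map digit vs),
      j := tape_at (rev (map digit ys) @ digit y # l') [], 4 := tape_at [] [D0]])"
    (is "tm_runs _ _ _ ?t") using "5.IH"[of ?ts "digit ?z # l" "digit y # l'"] "5.prems" by auto
  from run have "tm_runs (tm_add i j) (3 * (length xs + length ys) + 4 + 3) ts ?t"
    unfolding tm_add_def
    by (rule tm_runs_while_act[rotated 2]) (use "5.prems" in \<open>auto simp: Let_def\<close>)+
  then have "tm_runs (tm_add i j) (3 * (length (x # xs) + length (y # ys)) + 4) ts ?t"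
    by (rule tm_runs_mono) simp
  then show ?case using us "5.prems"
    by (intro exI[of _ "?z # us"] exI[of _ vs]) (simp add: list_update_twice)
qed

lemma list_update_Cons_numeral [simp]:
  "(x # xs)[numeral v := y] = x # xs[pred_numeral v := y]"
  by (simp add: numeral_eq_Suc)

definition run_emit :: "nat \<Rightarrow> nat \<Rightarrow> letter \<Rightarrow> tm" where
  "run_emit i j x = tm_while (\<lambda>s. s ! i \<noteq> None)
    (tm_act (\<lambda>s. (idle s)(i := (s ! i, MRight), j := (Some x, MRight))))"

lemma tm_runs_run_emit:
  assumes "i < length ts" "j < length ts" "i \<noteq> j" "ts ! i = tape_at l r" "ts ! j = tape_at u []"
  shows "tm_runs (run_emit i j x) (3 * length r + 1) ts
    (ts[i := tape_at (rev r @ l) [], j := tape_at (replicate (length r) x @ u) []])"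
  using assms
proof (induction r arbitrary: ts l u)
  case Nil
  then have "ts[i := tape_at l [], j := tape_at u []] = ts" by (metis list_update_id)
  moreover have "tm_runs (run_emit i j x) 1 ts ts"
    unfolding run_emit_def by (rule tm_runs_while_stop) (use Nil in simp)
  ultimately show ?case by simp
next
  case (Cons y r)
  let ?ts = "ts[i := tape_at (y # l) r, j := tape_at (x # u) []]"
  have "tm_runs (run_emit i j x) (3 * length r + 1) ?ts
    (?ts[i := tape_at (rev r @ y # l) [], j := tape_at (replicate (length r) x @ x # u) []])"
    using Cons.prems by (intro Cons.IH) auto
  then have "tm_runs (run_emit i j x) (3 * length r + 1 + 3) ts
    (?ts[i := tape_at (rev r @ y # l) [], j := tape_at (replicate (length r) x @ x # u) []])"
    unfolding run_emit_def
    by (rule tm_runs_while_act[rotated 2]) (use Cons.prems in auto)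
  then show ?case using Cons.prems by (simp add: list_update_twice replicate_app_Cons_same)
qed

lemma take_append_replicate_Cons:
  "take n (xs @ y # replicate n y) = take n (xs @ replicate n y)"
proof -
  have "take m (y # replicate n y) = take m (replicate n y)" if "m \<le> n" for m
    using that by (simp add: min_absorb1 flip: replicate_Suc)
  then show ?thesis by simp
qed

text \<open>Advances on tape 2 by the length of the unary tape 5, padding a number that is too short
  with zeros.\<close>

definition shift_head :: tm where
  "shift_head = tm_while (\<lambda>s. s ! 5 \<noteq> None) (tm_act (\<lambda>s. (idle s)(5 := (s ! 5, MRight),
    2 := (if s ! 2 = None then Some D0 else s ! 2, MRight))))"

lemma tm_runs_shift_head:
  assumes "5 < length ts" "ts ! 5 = tape_at u r" "ts ! 2 = tape_at l (map digit xs)"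
  shows "tm_runs shift_head (3 * length r + 1) ts (ts[5 := tape_at (rev r @ u) [],
    2 := tape_at (rev (map digit (take (length r) (xs @ replicate (length r) False))) @ l)
      (map digit (drop (length r) xs))])"
  using assms
proof (induction r arbitrary: ts u l xs)
  case Nil
  then have "ts[5 := tape_at u [], 2 := tape_at l (map digit xs)] = ts" by (metis list_update_id)
  moreover have "tm_runs shift_head 1 ts ts"
    unfolding shift_head_def by (rule tm_runs_while_stop) (use Nil in simp)
  ultimately show ?case by simp
next
  case (Cons y r)
  let ?x = "xs \<noteq> [] \<and> hd xs"
  let ?ts = "ts[5 := tape_at (y # u) r, 2 := tape_at (digit ?x # l) (map digit (tl xs))]"
  let ?ts' = "?ts[5 := tape_at (rev r @ y # u) [],
    2 := tape_at (rev (map digit (take (length r) (tl xs @ replicate (length r) False))) @ digit ?x # l)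
      (map digit (drop (length r) (tl xs)))]"
  have "tm_runs shift_head (3 * length r + 1) ?ts ?ts'"
    using Cons.prems by (intro Cons.IH) auto
  then have "tm_runs shift_head (3 * length r + 1 + 3) ts ?ts'"
    unfolding shift_head_def
    by (rule tm_runs_while_act[rotated 2]) (use Cons.prems in \<open>cases xs; auto\<close>)+
  moreover have "?ts' = ts[5 := tape_at (rev (y # r) @ u) [],
    2 := tape_at (rev (map digit (take (length (y # r)) (xs @ replicate (length (y # r)) False))) @ l)
      (map digit (drop (length (y # r)) xs))]"
    by (cases xs) (simp_all add: list_update_twice take_append_replicate_Cons del: take_append)
  ultimately show ?case by simp
qed

text \<open>Tape 0 has no end marker; it is brought back together with tape 5, which has one.
  The last, extra, left move does nothing on tape 0.\<close>

definition rewind_input :: tm where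
  "rewind_input = tm_while (\<lambda>s. s ! 5 \<noteq> Some Plus)
    (tm_act (\<lambda>s. (idle s)(0 := (s ! 0, MLeft), 5 := (s ! 5, MLeft))))"

lemma tm_runs_rewind_input:
  assumes "ts \<noteq> []" "5 < length ts" "ts ! 5 = tape_at (replicate n D1 @ [Plus]) (replicate k D1)"
    "ts ! 0 = tape_at (replicate n D1) (replicate k D1)"
  shows "tm_runs rewind_input (3 * n + 4) ts
    (ts[0 := tape_at [] (replicate (n + k) D1), 5 := tape_at [] (Plus # replicate (n + k) D1)])"
  using assms
proof (induction n arbitrary: ts k)
  case 0
  have "tm_runs rewind_input (1 + 3) ts (ts[0 := tape_at [] (replicate k D1), 5 := tape_at [] (Plus # replicate k D1)])"
    unfolding rewind_input_def
    by (rule tm_runs_while_act[OF _ _ tm_runs_while_stop]) (use 0 in \<open>cases k; simp\<close>)+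
  then show ?case by simp
next
  case (Suc n)
  let ?ts = "ts[0 := tape_at (replicate n D1) (replicate (Suc k) D1),
    5 := tape_at (replicate n D1 @ [Plus]) (replicate (Suc k) D1)]"
  let ?ts' = "?ts[0 := tape_at [] (replicate (n + Suc k) D1), 5 := tape_at [] (Plus # replicate (n + Suc k) D1)]"
  have "tm_runs rewind_input (3 * n + 4) ?ts ?ts'"
    using Suc.prems by (intro Suc.IH) auto
  then have "tm_runs rewind_input (3 * n + 4 + 3) ts ?ts'"
    unfolding rewind_input_def
    by (rule tm_runs_while_act[rotated 2]) (use Suc.prems in \<open>cases k; auto\<close>)+
  then show ?case by (simp add: list_update_twice)
qed

section \<open>Layout of the tapes and one round of the recursion\<close>

text \<open>Tape 0 is the input, read once as the loop counter; tape 1 is the output, tapes 2 and 3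
  hold the two numbers with the least significant digit first, tape 4 the carry. Tape 5 is a unary
  counter which together with its marker has d + 1 symbols, exactly the exponent of
  \<open>T\<close>.\<close>

definition tapes :: "nat \<Rightarrow> tape \<Rightarrow> letter list \<Rightarrow> bool list \<times> bool list \<Rightarrow> tape list" where
  "tapes d t out ab = [t, tape_at (rev out) [], tape_at [] (Plus # map digit (fst ab)),
    tape_at [] (Plus # map digit (snd ab)), tape_at [] [D0], tape_at [] (Plus # replicate d D1)]"

lemma Plus_notin_digits [simp]: "Plus \<notin> digit ` A"
  by (auto simp: image_iff)

definition skip_markers :: "letter option list \<Rightarrow> nat \<Rightarrow> letter option \<times> move" where
  "skip_markers s = (idle s)(2 := (s ! 2, MRight), 3 := (s ! 3, MRight))"

definition iteration :: tm where
  "iteration = tm_act (\<lambda>s. (skip_markers s)(0 := (s ! 0, MRight))) \<Zsemi> shift_head \<Zsemi> tm_add 2 3 \<Zsemi>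
    rewind 2 \<Zsemi> rewind 3 \<Zsemi> rewind 5 \<Zsemi> tm_act skip_markers \<Zsemi> tm_add 3 2 \<Zsemi> rewind 2 \<Zsemi> rewind 3"

lemma tm_runs_iteration:
  assumes "bit_pairs (Suc d) k = (a, b)" "bit_pairs (Suc d) (Suc k) = (a', b')"
    and N: "length a \<le> N" "length b \<le> N" "length a' \<le> N" "d \<le> N"
  shows "tm_runs iteration (33 * N + 43) (tapes d (tape_at l (x # r)) out (a, b))
    (tapes d (tape_at (x # l) r) out (a', b'))"
proof -
  define p q where "p = take (Suc d) (a @ replicate (Suc d) False)" and "q = drop (Suc d) a"
  have a': "a' = p @ add_bits False q b" and b': "b' = add_bits False b a'"
    using assms(1,2) by (auto simp: Let_def add_shifted_def p_def q_def)
  let ?t = "tape_at (x # l) r" and ?o = "tape_at (rev out) []" and ?c = "tape_at [] [D0]"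
    and ?u = "tape_at [] (Plus # replicate d D1)" and ?u' = "tape_at (replicate d D1 @ [Plus]) []"
  let ?ts1 = "[?t, ?o, tape_at [Plus] (map digit a), tape_at [Plus] (map digit b), ?c, ?u]"
  let ?ts2 = "[?t, ?o, tape_at (rev (map digit p) @ [Plus]) (map digit q), tape_at [Plus] (map digit b), ?c, ?u']"
  have 1: "tm_runs (tm_act (\<lambda>s. (skip_markers s)(0 := (s ! 0, MRight)))) 1
      (tapes d (tape_at l (x # r)) out (a, b)) ?ts1"
    by (rule tm_runs_act) (simp add: tapes_def skip_markers_def)
  have 2: "tm_runs shift_head (3 * (Suc d) + 1) ?ts1 ?ts2"
    using tm_runs_shift_head[of ?ts1 "[]" "Plus # replicate d D1" "[Plus]" a] by (simp add: p_def q_def)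
  obtain us vs where uv: "us @ vs = add_bits False q b" and 3: "tm_runs (tm_add 2 3) (3 * (length q + length b) + 4) ?ts2
     [?t, ?o, tape_at (rev (map digit us) @ rev (map digit p) @ [Plus]) (map digit vs),
      tape_at (rev (map digit b) @ [Plus]) [], ?c, ?u']" (is "tm_runs _ _ _ ?ts3")
    using tm_runs_add[of 2 ?ts2 3 "rev (map digit p) @ [Plus]" q "[Plus]" b False] by auto
  let ?ts4 = "[?t, ?o, tape_at [] (Plus # map digit a'), tape_at (rev (map digit b) @ [Plus]) [], ?c, ?u']"
  let ?ts5 = "[?t, ?o, tape_at [] (Plus # map digit a'), tape_at [] (Plus # map digit b), ?c, ?u']"
  let ?ts7 = "[?t, ?o, tape_at [Plus] (map digit a'), tape_at [Plus] (map digit b), ?c, ?u]"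
  have "map digit a' = map digit p @ map digit us @ map digit vs"
    unfolding a' uv[symmetric] by simp
  then have 4: "tm_runs (rewind 2) (3 * length (us @ p) + 4) ?ts3 ?ts4"
    using tm_runs_rewind[of 2 ?ts3 "rev (map digit us) @ rev (map digit p)" "map digit vs"] by simp
  have 5: "tm_runs (rewind 3) (3 * length b + 4) ?ts4 ?ts5"
    using tm_runs_rewind[of 3 ?ts4 "rev (map digit b)" "[]"] by simp
  have 6: "tm_runs (rewind 5) (3 * d + 4) ?ts5 (tapes d ?t out (a', b))"
    using tm_runs_rewind[of 5 ?ts5 "replicate d D1" "[]"] by (simp add: tapes_def)
  have 7: "tm_runs (tm_act skip_markers) 1 (tapes d ?t out (a', b)) ?ts7"
    by (rule tm_runs_act) (simp add: tapes_def skip_markers_def)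
  obtain us' vs' where uv': "us' @ vs' = b'" and 8: "tm_runs (tm_add 3 2) (3 * (length b + length a') + 4) ?ts7
     [?t, ?o, tape_at (rev (map digit a') @ [Plus]) [],
      tape_at (rev (map digit us') @ [Plus]) (map digit vs'), ?c, ?u]" (is "tm_runs _ _ _ ?ts8")
    using tm_runs_add[of 3 ?ts7 2 "[Plus]" b "[Plus]" a' False] b' by auto
  let ?ts9 = "[?t, ?o, tape_at [] (Plus # map digit a'), tape_at (rev (map digit us') @ [Plus]) (map digit vs'), ?c, ?u]"
  have 9: "tm_runs (rewind 2) (3 * length a' + 4) ?ts8 ?ts9"
    using tm_runs_rewind[of 2 ?ts8 "rev (map digit a')" "[]"] by simp
  have 10: "tm_runs (rewind 3) (3 * length us' + 4) ?ts9 (tapes d ?t out (a', b'))"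
    using tm_runs_rewind[of 3 ?ts9 "rev (map digit us')" "map digit vs'"]
    by (simp add: tapes_def uv'[symmetric])
  have "length us + length p \<le> length a'" using uv a' by (metis add.commute length_append le_add1 add_le_cancel_left)
  moreover have "length us' \<le> Suc (max (length b) (length a'))"
    using uv' length_add_bits[of False b a'] unfolding b'[symmetric] by auto
  moreover have "length q \<le> length a" by (simp add: q_def)
  ultimately show ?thesis
    unfolding iteration_def using N
    by (intro tm_runs_mono[OF tm_runs_seq[OF 1 tm_runs_seq[OF 2 tm_runs_seq[OF 3 tm_runs_seq[OF 4
      tm_runs_seq[OF 5 tm_runs_seq[OF 6 tm_runs_seq[OF 7 tm_runs_seq[OF 8 tm_runs_seq[OF 9 10]]]]]]]]]]) simp
qed

definition prepare :: tm where
  "prepare = tm_act (\<lambda>s. (idle s)(2 := (Some Plus, MRight), 3 := (Some Plus, MRight), 4 := (Some D0, MStay),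
      5 := (Some Plus, MRight))) \<Zsemi>
    tm_act (\<lambda>s. (idle s)(2 := (Some D1, MRight), 3 := (Some D1, MRight))) \<Zsemi>
    run_emit 0 5 D1 \<Zsemi> rewind_input \<Zsemi> rewind 2 \<Zsemi> rewind 3"

lemma tm_runs_prepare:
  "tm_runs prepare (6 * d + 21) (tape_at [] (replicate d D1) # replicate 5 (tape_at [] []))
    (tapes d (tape_at [] (replicate d D1)) [] ([True], [True]))"
proof -
  let ?i = "tape_at [] (replicate d D1)" and ?o = "tape_at [] []" and ?c = "tape_at [] [D0]"
    and ?b = "tape_at [D1, Plus] []" and ?a = "tape_at [] [Plus, D1]"
  let ?ts1 = "[?i, ?o, tape_at [Plus] [], tape_at [Plus] [], ?c, tape_at [Plus] []]"
  let ?ts2 = "[?i, ?o, ?b, ?b, ?c, tape_at [Plus] []]"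
  let ?ts3 = "[tape_at (replicate d D1) [], ?o, ?b, ?b, ?c, tape_at (replicate d D1 @ [Plus]) []]"
  let ?u = "tape_at [] (Plus # replicate d D1)"
  have 1: "tm_runs (tm_act (\<lambda>s. (idle s)(2 := (Some Plus, MRight), 3 := (Some Plus, MRight), 4 := (Some D0, MStay),
      5 := (Some Plus, MRight)))) 1 (tape_at [] (replicate d D1) # replicate 5 (tape_at [] [])) ?ts1"
    by (rule tm_runs_act) (simp add: numeral_eq_Suc)
  have 2: "tm_runs (tm_act (\<lambda>s. (idle s)(2 := (Some D1, MRight), 3 := (Some D1, MRight)))) 1 ?ts1 ?ts2"
    by (rule tm_runs_act) simp
  have 3: "tm_runs (run_emit 0 5 D1) (3 * d + 1) ?ts2 ?ts3"
    using tm_runs_run_emit[of 0 ?ts2 5 "[]" "replicate d D1" "[Plus]" D1] by simp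
  have 4: "tm_runs rewind_input (3 * d + 4) ?ts3 [?i, ?o, ?b, ?b, ?c, ?u]" (is "tm_runs _ _ _ ?ts4")
    using tm_runs_rewind_input[of ?ts3 d 0] by simp
  have 5: "tm_runs (rewind 2) 7 ?ts4 [?i, ?o, ?a, ?b, ?c, ?u]" (is "tm_runs _ _ _ ?ts5")
    using tm_runs_rewind[of 2 ?ts4 "[D1]" "[]"] by simp
  have 6: "tm_runs (rewind 3) 7 ?ts5 (tapes d ?i [] ([True], [True]))"
    using tm_runs_rewind[of 3 ?ts5 "[D1]" "[]"] by (simp add: tapes_def)
  show ?thesis
    unfolding prepare_def
    by (intro tm_runs_mono[OF tm_runs_seq[OF 1 tm_runs_seq[OF 2 tm_runs_seq[OF 3 tm_runs_seq[OF 4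
      tm_runs_seq[OF 5 6]]]]]]) simp
qed

section \<open>Writing a template whose parts depend on d\<close>

text \<open>The machine must not depend on d, so the word of the formula is a fixed list of pieces.
  In binary the remaining dependence on d is simple: multiplication by \<open>T\<close> appends d +
  1 zeros, \<open>T\<close> is a 1 with d + 1 zeros, and \<open>2 * T - 1\<close> consists of d + 2
  ones.\<close>

datatype piece = Lit letter | Alpha | Beta | Fill letter

fun render :: "nat \<Rightarrow> bool list \<times> bool list \<Rightarrow> piece \<Rightarrow> letter list" where
  "render d ab (Lit x) = [x]"
| "render d ab Alpha = rev (map digit (fst ab))"
| "render d ab Beta = rev (map digit (snd ab))"
| "render d ab (Fill x) = replicate (Suc d) x"

fun emit :: "piece \<Rightarrow> tm" where
  "emit (Lit x) = tm_act (\<lambda>s. (idle s)(1 := (Some x, MRight)))"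
| "emit Alpha = run_right 2 \<Zsemi> rewind_emit 2"
| "emit Beta = run_right 3 \<Zsemi> rewind_emit 3"
| "emit (Fill x) = run_emit 5 1 x \<Zsemi> rewind 5"

lemma tm_runs_emit:
  assumes "length (fst ab) \<le> N" "length (snd ab) \<le> N" "d \<le> N"
  shows "tm_runs (emit x) (6 * N + 8) (tapes d t out ab) (tapes d t (out @ render d ab x) ab)"
proof (cases x)
  case (Lit y)
  have "tm_runs (emit x) 1 (tapes d t out ab) (tapes d t (out @ render d ab x) ab)"
    unfolding Lit emit.simps by (rule tm_runs_act) (simp add: tapes_def)
  then show ?thesis by (rule tm_runs_mono) simp
next
  case Alpha
  let ?ts = "(tapes d t out ab)[2 := tape_at (rev (map digit (fst ab)) @ [Plus]) []]"
  have "tm_runs (run_right 2) (3 * length (fst ab) + 4) (tapes d t out ab) ?ts"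
    using tm_runs_run_right[of 2 "tapes d t out ab" "[]" "Plus # map digit (fst ab)"] by (simp add: tapes_def add.commute)
  moreover have "tm_runs (rewind_emit 2) (3 * length (fst ab) + 4) ?ts (tapes d t (out @ render d ab x) ab)"
    using tm_runs_rewind_emit[of 2 ?ts "rev (map digit (fst ab))" "[]" "rev out"] by (simp add: tapes_def Alpha)
  ultimately show ?thesis
    unfolding Alpha emit.simps by (rule tm_runs_mono[OF tm_runs_seq]) (use assms in simp)
next
  case Beta
  let ?ts = "(tapes d t out ab)[3 := tape_at (rev (map digit (snd ab)) @ [Plus]) []]"
  have "tm_runs (run_right 3) (3 * length (snd ab) + 4) (tapes d t out ab) ?ts"
    using tm_runs_run_right[of 3 "tapes d t out ab" "[]" "Plus # map digit (snd ab)"] by (simp add: tapes_def add.commute)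
  moreover have "tm_runs (rewind_emit 3) (3 * length (snd ab) + 4) ?ts (tapes d t (out @ render d ab x) ab)"
    using tm_runs_rewind_emit[of 3 ?ts "rev (map digit (snd ab))" "[]" "rev out"] by (simp add: tapes_def Beta)
  ultimately show ?thesis
    unfolding Beta emit.simps by (rule tm_runs_mono[OF tm_runs_seq]) (use assms in simp)
next
  case (Fill y)
  let ?ts = "(tapes d t (out @ render d ab x) ab)[5 := tape_at (replicate d D1 @ [Plus]) []]"
  have "tm_runs (run_emit 5 1 y) (3 * d + 4) (tapes d t out ab) ?ts"
    using tm_runs_run_emit[of 5 "tapes d t out ab" 1 "[]" "Plus # replicate d D1" "rev out" y]
    by (simp add: tapes_def Fill add.commute replicate_app_Cons_same)
  moreover have "tm_runs (rewind 5) (3 * d + 4) ?ts (tapes d t (out @ render d ab x) ab)"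
    using tm_runs_rewind[of 5 ?ts "replicate d D1" "[]"] by (simp add: tapes_def)
  ultimately show ?thesis
    unfolding Fill emit.simps by (rule tm_runs_mono[OF tm_runs_seq]) (use assms in simp)
qed

definition emit_all :: "piece list \<Rightarrow> tm" where
  "emit_all xs = foldr (\<lambda>x M. emit x \<Zsemi> M) xs []"

lemma tm_runs_emit_all:
  assumes "length (fst ab) \<le> N" "length (snd ab) \<le> N" "d \<le> N"
  shows "tm_runs (emit_all xs) (length xs * (6 * N + 8)) (tapes d t out ab)
    (tapes d t (out @ concat (map (render d ab) xs)) ab)"
proof (induction xs arbitrary: out)
  case Nil
  show ?case by (simp add: emit_all_def tm_runs_def)
next
  case (Cons x xs)
  have "tm_runs (emit x \<Zsemi> emit_all xs) ((6 * N + 8) + length xs * (6 * N + 8)) (tapes d t out ab)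
    (tapes d t ((out @ render d ab x) @ concat (map (render d ab) xs)) ab)"
    by (rule tm_runs_seq[OF tm_runs_emit[OF assms] Cons.IH])
  then show ?case by (simp add: emit_all_def)
qed

definition machine :: "piece list \<Rightarrow> tm" where
  "machine xs = prepare \<Zsemi> tm_while (\<lambda>s. s ! 0 \<noteq> None) iteration \<Zsemi> emit_all xs"

lemma length_bit_pairs:
  assumes "k \<le> d" "1 \<le> d"
  shows "length (fst (bit_pairs (Suc d) k)) \<le> 5 * d ^ 2" "length (snd (bit_pairs (Suc d) k)) \<le> 5 * d ^ 2"
proof -
  have "k * (d + 3) \<le> d * (d + 3)" using assms(1) by (rule mult_right_mono) simp
  also have "\<dots> = d ^ 2 + 3 * d" by (simp add: power2_eq_square algebra_simps)
  finally have "k * (Suc d + 2) \<le> d ^ 2 + 3 * d" by (simp add: algebra_simps)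
  moreover have "d \<le> d ^ 2" "1 \<le> d ^ 2" using assms(2) by (simp_all add: power2_eq_square)
  ultimately have "1 + k * (Suc d + 2) \<le> 5 * d ^ 2" by linarith
  then show "length (fst (bit_pairs (Suc d) k)) \<le> 5 * d ^ 2" "length (snd (bit_pairs (Suc d) k)) \<le> 5 * d ^ 2"
    using bit_pairs[of "Suc d" k] by (metis order_trans prod.collapse)+
qed

lemma machine_computes:
  assumes "1 \<le> d"
  shows "computes_in_time (machine xs) 6 (replicate d D1)
    (concat (map (render d (bit_pairs (Suc d) d)) xs)) ((300 + 38 * length xs) * d ^ 3)"
proof -
  define N where "N = 5 * d ^ 2"
  define out where "out = concat (map (render d (bit_pairs (Suc d) d)) xs)"
  have len: "length (fst (bit_pairs (Suc d) k)) \<le> N" "length (snd (bit_pairs (Suc d) k)) \<le> N" if "k \<le> d" for k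
    using length_bit_pairs[OF that assms] by (simp_all add: N_def)
  have dN: "d \<le> N" by (simp add: N_def power2_eq_square)
  \<comment> \<open>The situation after \<open>i\<close> rounds: the head on the input stands in
    cell \<open>i\<close>, so the loop meets the first blank after d rounds.\<close>
  define f where "f i = tapes d (tape_at (replicate i D1) (replicate (d - i) D1)) [] (bit_pairs (Suc d) i)" for i
  have "tm_runs prepare (6 * d + 21) (tape_at [] (replicate d D1) # replicate 5 (tape_at [] [])) (f 0)"
    using tm_runs_prepare by (simp add: f_def)
  moreover have "tm_runs (tm_while (\<lambda>s. s ! 0 \<noteq> None) iteration) (d * (33 * N + 43 + 2) + 1) (f 0) (f d)"
  proof (rule tm_runs_while_iterate)
    fix i assume i: "i < d"
    obtain a b a' b' where ab: "bit_pairs (Suc d) i = (a, b)" "bit_pairs (Suc d) (Suc i) = (a', b')"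
      by fastforce
    have "tm_runs iteration (33 * N + 43) (tapes d (tape_at (replicate i D1) (D1 # replicate (d - Suc i) D1)) [] (a, b))
      (tapes d (tape_at (D1 # replicate i D1) (replicate (d - Suc i) D1)) [] (a', b'))"
      using len[of i] len[of "Suc i"] dN i ab by (intro tm_runs_iteration) auto
    moreover have "D1 # replicate (d - Suc i) D1 = replicate (d - i) D1"
      using i by (simp flip: replicate_Suc add: Suc_diff_Suc)
    ultimately show "scan (f i) ! 0 \<noteq> None \<and> tm_runs iteration (33 * N + 43) (f i) (f (Suc i))"
      using ab by (auto simp: f_def tapes_def) (metis option.distinct(1) read_tape_at(2))
  qed (simp add: f_def tapes_def)
  moreover have "tm_runs (emit_all xs) (length xs * (6 * N + 8)) (f d) (tapes d (tape_at (replicate d D1) []) out (bit_pairs (Suc d) d))"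
    using tm_runs_emit_all[OF len dN, of d xs _ "[]"] by (simp add: f_def out_def)
  ultimately have run: "tm_runs (machine xs) (6 * d + 21 + (d * (33 * N + 43 + 2) + 1 + length xs * (6 * N + 8)))
    (tape_at [] (replicate d D1) # replicate 5 (tape_at [] [])) (tapes d (tape_at (replicate d D1) []) out (bit_pairs (Suc d) d))"
    unfolding machine_def by (intro tm_runs_seq)
  have bound: "6 * d + 21 + (d * (33 * N + 43 + 2) + 1 + length xs * (6 * N + 8)) \<le> (300 + 38 * length xs) * d ^ 3"
  proof -
    have "1 \<le> d ^ 3" "d \<le> d ^ 3" "d ^ 2 \<le> d ^ 3" 
      using assms by (simp_all add: power_increasing self_le_power)
    moreover from this have "6 * N + 8 \<le> 38 * d ^ 3" by (simp add: N_def)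
    then have "length xs * (6 * N + 8) \<le> length xs * (38 * d ^ 3)" by (rule mult_left_mono) simp
    moreover have "d * (33 * N + 43 + 2) = 165 * d ^ 3 + 45 * d"
      by (simp add: N_def power2_eq_square power3_eq_cube algebra_simps)
    ultimately show ?thesis by (simp add: algebra_simps)
  qed
  obtain m where "m \<le> 6 * d + 21 + (d * (33 * N + 43 + 2) + 1 + length xs * (6 * N + 8))"
    and m: "(tm_step (machine xs) ^^ m) (0, tape_at [] (replicate d D1) # replicate 5 (tape_at [] [])) =
      (length (machine xs), tapes d (tape_at (replicate d D1) []) out (bit_pairs (Suc d) d))"
    using run by (auto simp: tm_runs_def)
  then have "m \<le> (300 + 38 * length xs) * d ^ 3" using bound by linarith
  moreover have "initial_config 6 (replicate d D1) = (0, tape_at [] (replicate d D1) # replicate 5 (tape_at [] []))"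
    by (simp add: initial_config_def tape_at_def)
  moreover have "fst (tapes d t out ab ! 1) = tape_contents out" for t ab
    by (simp add: tapes_def tape_at_def)
  ultimately show ?thesis
    unfolding computes_in_time_def out_def[symmetric]
    by (intro exI[of _ m] exI[of _ "length (machine xs)"] exI[of _ "tapes d (tape_at (replicate d D1) []) out (bit_pairs (Suc d) d)"])
      (simp add: m)
qed

section \<open>The machine writes the formula\<close>

definition ineq_pieces :: "(piece list \<times> nat) list \<Rightarrow> piece list \<Rightarrow> piece list" where
  "ineq_pieces ts b = concat (map (\<lambda>(a, v). Lit Plus # a @ Lit Var # map Lit (nat_word v)) ts) @ Lit Leq # b"

definition psi_pieces :: "piece list" where
  "psi_pieces = (let
      p = [Alpha]; q = [Beta, Fill D0]; T = [Lit D1, Fill D0]; M = [Lit D1, Fill D1];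
      neg = (\<lambda>c. Lit Minus # c); lit = (\<lambda>i. map Lit (int_word i)); conj = (\<lambda>F G. Lit LAnd # F @ G)
    in
    conj (ineq_pieces [(neg q, 2), (p, 3)] (lit 0))
   (conj (Lit LNeg #
      (conj (ineq_pieces [(lit (-1), 7)] (lit 0))
      (conj (ineq_pieces [(neg q, 6), (p, 7)] (lit 0))
      (conj (ineq_pieces [(lit 1, 7), (lit (-1), 3)] (lit 0))
      (conj (ineq_pieces [(neg q, 2), (q, 6), (p, 3), (neg p, 7)] (lit 0))
      (conj (ineq_pieces [(lit (-1), 6)] (lit (-1)))
            (ineq_pieces [(lit 1, 6), (lit (-1), 2)] (lit (-1)))))))))
   (conj (ineq_pieces [(lit 1, 0), (lit (-1), 3)] (lit 0))
   (conj (ineq_pieces [(lit 1, 3), (neg T, 0)] (lit (-1)))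
   (conj (ineq_pieces [(lit 1, 3), (lit (-1), 1), (neg T, 4)] (lit 0))
   (conj (ineq_pieces [(lit (-1), 3), (lit 1, 1), (T, 4)] (lit 0))
   (conj (ineq_pieces [(lit (-1), 2), (lit (-2), 3), (M, 5)] (neg T))
         (ineq_pieces [(lit 1, 2), (lit 2, 3), (neg M, 5)] M))))))))"

lemma concat_render_Lit: "concat (map (render d ab) (map Lit w)) = w"
  by (induction w) auto

lemma render_ineq_pieces:
  "concat (map (render d ab) (ineq_pieces ts b)) =
    concat (map (\<lambda>(a, v). Plus # concat (map (render d ab) a) @ Var # nat_word v) ts) @
      Leq # concat (map (render d ab) b)"
  by (induction ts) (auto simp: ineq_pieces_def concat_render_Lit[simplified])

lemma render_psi_pieces:
  "concat (map (render d (bit_pairs (Suc d) d)) psi_pieces) = encode (formula d)"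
proof -
  obtain a b where ab: "bit_pairs (Suc d) d = (a, b)" by fastforce
  define T :: int where "T = 2 ^ Suc d"
  note bp = bit_pairs[OF ab, folded T_def]
  have p: "int_word (alpha T (Suc d)) = rev (map digit a)"
    "int_word (- alpha T (Suc d)) = Minus # rev (map digit a)"
    using int_word_bits[of a] bp by auto
  have "bits_val (replicate (Suc d) False @ b) = T * beta T (Suc d)"
    using bp by (simp only: bits_val_append bits_val_replicate length_replicate T_def)
  then have q: "int_word (T * beta T (Suc d)) = rev (map digit b) @ replicate (Suc d) D0"
    "int_word (- (T * beta T (Suc d))) = Minus # rev (map digit b) @ replicate (Suc d) D0"
    using int_word_bits[of "replicate (Suc d) False @ b"] bp by (auto simp: replicate_append_same)
  have "bits_val (replicate (Suc d) False @ [True]) = T"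
    unfolding bits_val_append bits_val_replicate length_replicate by (simp add: T_def)
  then have T: "int_word T = D1 # replicate (Suc d) D0" "int_word (- T) = Minus # D1 # replicate (Suc d) D0"
    using int_word_bits[of "replicate (Suc d) False @ [True]"] by (auto simp: replicate_append_same)
  have M: "bits_val (replicate (Suc (Suc d)) True) = 2 * T - 1"
    unfolding bits_val_replicate T_def by simp
  have "replicate (Suc (Suc d)) True \<noteq> []" "last (replicate (Suc (Suc d)) True)"
    using last_replicate[of "Suc (Suc d)" True] by simp_all
  from int_word_bits[OF this, unfolded M]
  have M: "int_word (2 * T - 1) = D1 # replicate (Suc d) D1"
    "int_word (- (2 * T - 1)) = Minus # D1 # replicate (Suc d) D1"
    by (simp_all add: replicate_append_same)
  have "formula d = psi (alpha T (Suc d)) (T * beta T (Suc d)) T (2 * T - 1)"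
    by (simp add: formula_def Let_def T_def)
  then show ?thesis
    unfolding psi_pieces_def Let_def
    by (simp add: ab psi_def render_ineq_pieces concat_render_Lit[simplified] p q T M
        del: replicate_Suc minus_diff_eq)
qed

lemma poly_time_computable_formula: "poly_time_computable (\<lambda>d. encode (formula d))"
  unfolding poly_time_computable_def
  using machine_computes[of _ psi_pieces] unfolding render_psi_pieces
  by (intro exI[of _ "machine psi_pieces"] exI[of _ 6] exI[of _ "300 + 38 * length psi_pieces"] exI[of _ 3]) auto

text \<open>The template has a fixed number of pieces, and each is rendered with at most
  \<open>5 * d ^ 2\<close> letters, so the bound is even quadratic.\<close>

lemma length_encode_formula:
  assumes "1 \<le> d"
  shows "length (encode (formula d)) \<le> length psi_pieces * (5 * d ^ 2)"
proof -
  have "d \<le> d ^ 2" using assms by (simp add: power2_eq_square)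
  then have "length (render d (bit_pairs (Suc d) d) x) \<le> 5 * d ^ 2" for x
    using length_bit_pairs[of d d] assms by (cases x) auto
  then have "length (concat (map (render d (bit_pairs (Suc d) d)) xs)) \<le> length xs * (5 * d ^ 2)" for xs
    by (induction xs) (auto intro: add_mono)
  then show ?thesis unfolding render_psi_pieces[symmetric] .
qed

lemma pa_length_quantified_formula:
  "\<exists>C. \<forall>d\<ge>1. pa_length (quantified_formula d) \<le> C * d ^ 3"
proof -
  define w where "w = concat (map (\<lambda>v. LEx # nat_word v) [2, 3, 4, 5]) @ concat (map (\<lambda>v. LAll # nat_word v) [6, 7])"
  have "pa_length (quantified_formula d) \<le> (4 * (length w + length psi_pieces * 5)) * d ^ 3" if d: "1 \<le> d" for d
  proof -
    have "d ^ 2 \<le> d ^ 3" "1 \<le> d ^ 3" using d by (simp_all add: power_increasing)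
    have "length (encode (quantified_formula d)) = length w + length (encode (formula d))"
      by (simp add: w_def)
    also have "\<dots> \<le> length w * d ^ 3 + length psi_pieces * (5 * d ^ 3)"
      using length_encode_formula[OF d] \<open>1 \<le> d ^ 3\<close> \<open>d ^ 2 \<le> d ^ 3\<close>
      by (intro add_mono order_trans[OF length_encode_formula[OF d]] mult_left_mono) auto
    finally show ?thesis by (simp add: pa_length_def algebra_simps)
  qed
  then show ?thesis by blast
qed

theorem theorem3:
  shows "\<exists>(C::nat) (x::nat) (y::nat) (us :: nat \<Rightarrow> nat list) (vs :: nat \<Rightarrow> nat list) (\<Psi> :: nat \<Rightarrow> pa).
    (\<forall>d\<ge>1.
      let F = Exs (us d) (Alls (vs d) (\<Psi> d)) in
        distinct ([x, y] @ us d @ vs d) \<and>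
        quantifier_free (\<Psi> d) \<and>
        free_vars F \<subseteq> {x, y} \<and>
        F \<in> Short_PA 10 18 \<and>
        pa_length F \<le> C * d ^ 3 \<and>
        VC_pa [x] [y] F \<ge> enat d) \<and>
    poly_time_computable (\<lambda>d. encode (\<Psi> d))"
proof -
  obtain C where C: "\<And>d. 1 \<le> d \<Longrightarrow> pa_length (quantified_formula d) \<le> C * d ^ 3"
    using pa_length_quantified_formula by blast
  have short: "quantified_formula d \<in> Short_PA 10 18" for d
    using quantified_formula_in_Short_PA[of d] unfolding Short_PA_def by auto
  show ?thesis
    unfolding Let_def
    by (intro exI[of _ C] exI[of _ 0] exI[of _ 1] exI[of _ "\<lambda>_. [2, 3, 4, 5]"] exI[of _ "\<lambda>_. [6, 7]"]
        exI[of _ formula] conjI allI impI poly_time_computable_formula C VC_quantified_formula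
        quantifier_free_formula short)
      (simp_all only: free_vars_quantified_formula, simp_all)
qed

end
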